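(* Let $p>1$ and let $X,Y\in\mathcal{B}_p(\mathcal{H})\setminus\{0\}$. The following conditions are equivalent: (1) $|\alpha_{Y,X}|=1$. (2) $X\parallel^p Y$. (3) $Y\parallel^p X$. (4) $|\alpha_{X,Y}|=1$.
   Context: $\mathcal{H}$ is a separable complex Hilbert space, and $\mathcal{B}_p(\mathcal{H})$ is the Schatten $p$-class, i.e. the compact operators $X$ on $\mathcal{H}$ whose singular values satisfy $\|X\|_p=\left(\sum_n s_n(X)^p\right)^{1/p}<\infty$. Write $|X|=(X^*X)^{1/2}$ and let $X=U|X|$ be a polar decomposition with $U$ a partial isometry. For $p>1$ and $X,Y\in\mathcal{B}_p(\mathcal{H})$, $X\neq 0$, the semi-inner product is $$[Y,X]_p=\|X\|_p^{2-p}\operatorname{tr}\left(|X|^{p-1}U^*Y\right)$$ (for $p>1$ this does not depend on the choice of polar decomposition). For nonzero $X,Y\in\mathcal{B}_p(\mathcal{H})$ put $\alpha_{Y,X}=\frac{[Y,X]_p}{\|X\|_p\|Y\|_p}$. Norm-parallelism: $X\parallel^p Y$ means there exists $\lambda\in\mathbb{C}$ with $|\lambda|=1$ such that $\|X+\lambda Y\|_p=\|X\|_p+\|Y\|_p$. *)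

theory Defs
  imports "HOL-Analysis.Analysis"
begin

section \<open>Complex Hilbert spaces\<close>

text \<open>The inner product is antilinear in the first and linear in the second argument. Norm, metric
  and topology are those of the class \<^class>\<open>banach\<close>; the last axiom ties the norm to the inner
  product (and contains positive definiteness).\<close>

class chilbert_space = banach +
  fixes scaleC :: "complex \<Rightarrow> 'a \<Rightarrow> 'a" (infixr "*\<^sub>C" 75)
    and cinner :: "'a \<Rightarrow> 'a \<Rightarrow> complex"
  assumes scaleR_scaleC: "r *\<^sub>R x = complex_of_real r *\<^sub>C x"
    and scaleC_add_right: "a *\<^sub>C (x + y) = a *\<^sub>C x + a *\<^sub>C y"
    and scaleC_add_left: "(a + b) *\<^sub>C x = a *\<^sub>C x + b *\<^sub>C x"
    and scaleC_scaleC: "a *\<^sub>C b *\<^sub>C x = (a * b) *\<^sub>C x"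
    and scaleC_one: "1 *\<^sub>C x = x"
    and cinner_commute: "cinner x y = cnj (cinner y x)"
    and cinner_add_right: "cinner x (y + z) = cinner x y + cinner x z"
    and cinner_scaleC_right: "cinner x (a *\<^sub>C y) = a * cinner x y"
    and cinner_self: "cinner x x = complex_of_real ((norm x)\<^sup>2)"

global_interpretation complex_vector: vector_space "scaleC :: complex \<Rightarrow> 'a \<Rightarrow> 'a::chilbert_space"
  defines cspan = complex_vector.span
    and cdim = complex_vector.dim
  by unfold_locales (fact scaleC_add_right scaleC_add_left scaleC_scaleC scaleC_one)+

definition orthonormal_basis :: "'a::chilbert_space set \<Rightarrow> bool" where
  "orthonormal_basis B \<longleftrightarrow>
     (\<forall>e\<in>B. norm e = 1) \<and> (\<forall>e\<in>B. \<forall>f\<in>B. e \<noteq> f \<longrightarrow> cinner e f = 0) \<and> closure (cspan B) = UNIV"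

section \<open>Operators\<close>

definition bounded_clinear :: "('a::chilbert_space \<Rightarrow> 'a) \<Rightarrow> bool" where
  "bounded_clinear T \<longleftrightarrow> bounded_linear T \<and> (\<forall>c v. T (c *\<^sub>C v) = c *\<^sub>C T v)"

definition compact_op :: "('a::chilbert_space \<Rightarrow> 'a) \<Rightarrow> bool" where
  "compact_op T \<longleftrightarrow> bounded_clinear T \<and> compact (closure (T ` cball 0 1))"

definition cadjoint :: "('a::chilbert_space \<Rightarrow> 'a) \<Rightarrow> 'a \<Rightarrow> 'a" where
  "cadjoint T = (THE S. \<forall>v w. cinner (S v) w = cinner v (T w))"

definition positive_op :: "('a::chilbert_space \<Rightarrow> 'a) \<Rightarrow> bool" where
  "positive_op T \<longleftrightarrow> bounded_clinear T \<and> (\<forall>v. cinner v (T v) \<in> \<real>\<^sub>\<ge>\<^sub>0)"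

definition abs_op :: "('a::chilbert_space \<Rightarrow> 'a) \<Rightarrow> 'a \<Rightarrow> 'a" where
  "abs_op X = (THE P. positive_op P \<and> P \<circ> P = cadjoint X \<circ> X)"

text \<open>The power \<open>T\<^sup>r\<close> (\<open>r > 0\<close>) of a positive compact operator, by functional calculus: since the
  eigenvectors of \<open>T\<close> span a dense subspace, \<open>T\<^sup>r\<close> is determined by being the scalar \<open>t\<^sup>r\<close> on the
  eigenspace of each eigenvalue \<open>t\<close>. Note \<open>0 powr r = 0\<close>; negative \<open>t\<close> only occur with \<open>v = 0\<close>.\<close>

definition op_powr :: "('a::chilbert_space \<Rightarrow> 'a) \<Rightarrow> real \<Rightarrow> 'a \<Rightarrow> 'a" where
  "op_powr T r = (THE S. bounded_clinear S \<and>
     (\<forall>(t::real) v. T v = complex_of_real t *\<^sub>C v \<longrightarrow> S v = complex_of_real (t powr r) *\<^sub>C v))"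

definition partial_isometry :: "('a::chilbert_space \<Rightarrow> 'a) \<Rightarrow> bool" where
  "partial_isometry U \<longleftrightarrow> bounded_clinear U \<and>
     (\<forall>v. (\<forall>w. U w = 0 \<longrightarrow> cinner w v = 0) \<longrightarrow> norm (U v) = norm v)"

definition polar_part :: "('a::chilbert_space \<Rightarrow> 'a) \<Rightarrow> 'a \<Rightarrow> 'a" where
  "polar_part X = (SOME U. partial_isometry U \<and> X = U \<circ> abs_op X)"

text \<open>For trace class operators the sum converges absolutely and does not depend on the basis.\<close>

definition op_trace :: "('a::chilbert_space \<Rightarrow> 'a) \<Rightarrow> complex" where
  "op_trace T = (\<Sum>\<^sub>\<infinity>e\<in>(SOME B. orthonormal_basis B). cinner e (T e))"

section \<open>Schatten classes\<close>

text \<open>The singular values of a compact operator \<open>X\<close>: the eigenvalues of \<open>|X|\<close> in decreasing order,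
  repeated according to multiplicity and, if only finitely many are nonzero, padded with zeros.
  The multiplicity condition is imposed for \<open>t > 0\<close> only, where the eigenspaces are
  finite-dimensional; together with monotonicity and convergence to 0 it determines the sequence.\<close>

definition singular_value :: "('a::chilbert_space \<Rightarrow> 'a) \<Rightarrow> nat \<Rightarrow> real" where
  "singular_value X = (THE s. decseq s \<and> s \<longlonglongrightarrow> 0 \<and>
     (\<forall>t>0. card {n. s n = t} = cdim {v. abs_op X v = complex_of_real t *\<^sub>C v}))"

definition schatten_class :: "real \<Rightarrow> ('a::chilbert_space \<Rightarrow> 'a) set" where
  "schatten_class p = {X. compact_op X \<and> summable (\<lambda>n. singular_value X n powr p)}"

definition schatten_norm :: "real \<Rightarrow> ('a::chilbert_space \<Rightarrow> 'a) \<Rightarrow> real" where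
  "schatten_norm p X = (\<Sum>n. singular_value X n powr p) powr (1 / p)"

text \<open>\<open>schatten_sip p Y X\<close> is \<open>[Y, X]\<^sub>p\<close>, linear in \<open>Y\<close>, and \<open>schatten_alpha p Y X\<close> is
  \<open>\<alpha>\<^bsub>Y,X\<^esub>\<close>.\<close>

definition schatten_sip :: "real \<Rightarrow> ('a::chilbert_space \<Rightarrow> 'a) \<Rightarrow> ('a \<Rightarrow> 'a) \<Rightarrow> complex" where
  "schatten_sip p Y X = complex_of_real (schatten_norm p X powr (2 - p)) *
     op_trace (op_powr (abs_op X) (p - 1) \<circ> cadjoint (polar_part X) \<circ> Y)"

definition schatten_alpha :: "real \<Rightarrow> ('a::chilbert_space \<Rightarrow> 'a) \<Rightarrow> ('a \<Rightarrow> 'a) \<Rightarrow> complex" where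
  "schatten_alpha p Y X =
     schatten_sip p Y X / complex_of_real (schatten_norm p X * schatten_norm p Y)"

definition schatten_parallel :: "real \<Rightarrow> ('a::chilbert_space \<Rightarrow> 'a) \<Rightarrow> ('a \<Rightarrow> 'a) \<Rightarrow> bool" where
  "schatten_parallel p X Y \<longleftrightarrow> (\<exists>c. cmod c = 1 \<and>
     schatten_norm p (\<lambda>v. X v + c *\<^sub>C Y v) = schatten_norm p X + schatten_norm p Y)"

end

(*
All four conditions are equivalent to Y being a nonzero multiple of X.

Let s_n, e_n, f_n be the singular values and singular vectors of X. The trace of |X|^(p-1) U* Y is
the sum of the s_n^(p-1) <f_n, Y e_n>. Insert a singular value decomposition (t_m, g_m, h_m) of Y
and bound |<f_n, h_m>| |<g_m, e_n>| by the mean of the squares, whose row and column sums are at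
most 1 by Bessel's inequality, and p s^(p-1) t by (p-1) s^p + t^p. This proves Hoelder's inequality
|[Y,X]| <= |X| |Y|, and if it is an equality then t_m = s_n (after normalization) whenever h_m or
g_m is not orthogonal to f_n or e_n, which forces Y to be a multiple of X. The same estimate, applied
to the singular vectors of X + cY, yields the triangle inequality, and equality there makes both X
and cY multiples of X + cY.
*)
theory Submission
  imports Defs
begin

section \<open>Hilbert space geometry\<close>

text \<open>The operator notions are definite or indefinite descriptions, so each must be tied to a
  concrete singular value decomposition before any estimate can start. Two choices need care. A
  polar part is arbitrary on the kernel of |X|, but only its values at the singular vectors of X
  enter. The trace is taken over an arbitrary orthonormal basis unrelated to those vectors; that it
  equals the sum over n is shown by cutting the series of rank-one operators at N, computing the
  trace of the finite part directly and controlling the rest by Hoelder's inequality itself. A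
  further obstacle: it is not known in advance that the p-th powers of the singular values of X + cY
  are summable, and an infinite sum without summability says nothing. Hence Hoelder's inequality is
  stated for finite sums, and summability comes out of it.\<close>

lemma cinner_add_left: "cinner (x + y) z = cinner x z + cinner y z"
  by (metis cinner_add_right cinner_commute complex_cnj_add)

lemma cinner_scaleC_left: "cinner (a *\<^sub>C x) y = cnj a * cinner x y"
  by (metis cinner_commute cinner_scaleC_right complex_cnj_mult)

lemma norm_scaleC: "norm (a *\<^sub>C x) = cmod a * norm x"
proof -
  have "complex_of_real ((norm (a *\<^sub>C x))\<^sup>2) = complex_of_real ((cmod a * norm x)\<^sup>2)"
    unfolding cinner_self[symmetric] cinner_scaleC_left cinner_scaleC_right
    by (simp add: cinner_self power_mult_distrib complex_norm_square[unfolded of_real_power] mult_ac)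
  hence "(norm (a *\<^sub>C x))\<^sup>2 = (cmod a * norm x)\<^sup>2"
    using of_real_eq_iff by blast
  thus ?thesis by (simp add: power2_eq_iff_nonneg)
qed

lemma cinner_scaleR_right: "cinner x (r *\<^sub>R y) = r *\<^sub>R cinner x y"
  by (simp add: scaleR_scaleC cinner_scaleC_right scaleR_conv_of_real)

lemma cinner_scaleR_left: "cinner (r *\<^sub>R x) y = r *\<^sub>R cinner x y"
  by (simp add: scaleR_scaleC cinner_scaleC_left scaleR_conv_of_real)

text \<open>The coefficient subtracted is the one that makes the remainder orthogonal to x.
  Nonnegativity of the remainder gives Cauchy-Schwarz, comparison with it gives orthogonality at a
  nearest point, and its iteration gives Bessel's inequality.\<close>

lemma norm_diff_projection:
  assumes "x \<noteq> 0"
  shows "(norm (y - (cinner x y / (norm x)\<^sup>2) *\<^sub>C x))\<^sup>2 = (norm y)\<^sup>2 - (cmod (cinner x y) / norm x)\<^sup>2"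
proof -
  define c where "c = cinner x y / (norm x)\<^sup>2"
  have z: "y - c *\<^sub>C x = y + (- c) *\<^sub>C x" by simp
  have "complex_of_real ((norm (y - c *\<^sub>C x))\<^sup>2) = cinner (y + (- c) *\<^sub>C x) (y + (- c) *\<^sub>C x)"
    by (simp only: cinner_self z[symmetric])
  also have "\<dots> = (norm y)\<^sup>2 - c * cinner y x - cnj c * cinner x y + cnj c * c * (norm x)\<^sup>2"
    unfolding cinner_add_left cinner_add_right cinner_scaleC_left cinner_scaleC_right
    by (simp add: cinner_self algebra_simps)
  also have "cnj c * c * (norm x)\<^sup>2 = c * cinner y x"
    using assms by (simp add: c_def cinner_commute[of y x] power2_eq_square)
  also have "cnj c * cinner x y = (cmod (cinner x y) / norm x)\<^sup>2"
    unfolding power_divide of_real_divide complex_norm_square by (simp add: c_def)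
  finally have "complex_of_real ((norm (y - c *\<^sub>C x))\<^sup>2) = of_real ((norm y)\<^sup>2 - (cmod (cinner x y) / norm x)\<^sup>2)"
    by simp
  thus ?thesis unfolding c_def using of_real_eq_iff by blast
qed

lemma cauchy_schwarz: "cmod (cinner x y) \<le> norm x * norm y"
proof (cases "x = 0")
  case True
  have "cinner 0 y = 0" using cinner_scaleC_left[of 0 0 y] by simp
  thus ?thesis using True by simp
next
  case False
  have "0 \<le> (norm y)\<^sup>2 - (cmod (cinner x y) / norm x)\<^sup>2"
    unfolding norm_diff_projection[OF False, symmetric] by simp
  hence "cmod (cinner x y) / norm x \<le> norm y" by (simp add: power2_le_iff_abs_le)
  thus ?thesis using False by (simp add: field_simps)
qed

global_interpretation cinner: bounded_bilinear "cinner :: 'a \<Rightarrow> 'a::chilbert_space \<Rightarrow> complex"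
proof
  show "\<exists>K. \<forall>a b. norm (cinner a b) \<le> norm a * norm b * K"
    by (rule exI[of _ 1]) (simp add: cauchy_schwarz)
qed (simp_all add: cinner_add_left cinner_add_right cinner_scaleR_left cinner_scaleR_right)

global_interpretation scaleC: bounded_bilinear "scaleC :: complex \<Rightarrow> 'a::chilbert_space \<Rightarrow> 'a"
proof
  show "\<exists>K. \<forall>a b. norm (a *\<^sub>C b :: 'a) \<le> norm a * norm b * K"
    by (rule exI[of _ 1]) (simp add: norm_scaleC)
qed (simp_all add: scaleC_add_right scaleC_add_left scaleR_scaleC scaleC_scaleC mult.commute scaleR_conv_of_real)

lemmas cinner_simps = cinner.add_left cinner.add_right cinner.diff_left cinner.diff_right
  cinner_scaleC_left cinner_scaleC_right

lemma cinner_zero_commute: "cinner x y = 0 \<longleftrightarrow> cinner y x = 0"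
  using cinner_commute[of x y] by simp

lemma cmod_cinner_commute: "cmod (cinner x y) = cmod (cinner y x)"
  using cinner_commute[of x y] by simp

lemma cinner_extensionality: "(\<And>w. cinner w x = cinner w y) \<Longrightarrow> x = y"
proof -
  assume "\<And>w. cinner w x = cinner w y"
  hence "cinner (x - y) (x - y) = 0" by (simp only: cinner.diff_right) simp
  thus ?thesis by (simp add: cinner_self)
qed

lemma norm_add_square: "(norm (x + y))\<^sup>2 = (norm x)\<^sup>2 + (norm y)\<^sup>2 + 2 * Re (cinner x y)"
proof -
  have "complex_of_real ((norm (x + y))\<^sup>2) = of_real ((norm x)\<^sup>2) + of_real ((norm y)\<^sup>2) + (cinner x y + cnj (cinner x y))"
    unfolding cinner_self[symmetric] by (simp add: cinner_simps cinner_commute[of y x])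
  also have "cinner x y + cnj (cinner x y) = of_real (2 * Re (cinner x y))"
    by (simp add: complex_add_cnj)
  finally have "complex_of_real ((norm (x + y))\<^sup>2) = of_real ((norm x)\<^sup>2 + (norm y)\<^sup>2 + 2 * Re (cinner x y))"
    by simp
  thus ?thesis using of_real_eq_iff by blast
qed

lemma norm_diff_square: "(norm (x - y))\<^sup>2 = (norm x)\<^sup>2 + (norm y)\<^sup>2 - 2 * Re (cinner x y)"
  using norm_add_square[of x "- y"] by (simp add: cinner.minus_right)

section \<open>Closed subspaces and nearest points\<close>

lemma subspace_closure:
  assumes "complex_vector.subspace (M :: 'a::chilbert_space set)"
  shows "complex_vector.subspace (closure M)"
proof (rule complex_vector.subspaceI)
  show "0 \<in> closure M"
    using assms closure_subset complex_vector.subspace_0 by blast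
  fix x y assume "x \<in> closure M" "y \<in> closure M"
  then obtain f g where *: "\<And>n. f n \<in> M" "f \<longlonglongrightarrow> x" "\<And>n. g n \<in> M" "g \<longlonglongrightarrow> y"
    unfolding closure_sequential by blast
  have "(\<lambda>n. f n + g n) \<longlonglongrightarrow> x + y" using * tendsto_add by blast
  moreover have "f n + g n \<in> M" for n using * assms complex_vector.subspace_add by blast
  ultimately show "x + y \<in> closure M"
    unfolding closure_sequential by (intro exI[of _ "\<lambda>n. f n + g n"]) simp
next
  fix c x assume "x \<in> closure M"
  then obtain f where *: "\<And>n. f n \<in> M" "f \<longlonglongrightarrow> x" 
    unfolding closure_sequential by blast
  have "(\<lambda>n. c *\<^sub>C f n) \<longlonglongrightarrow> c *\<^sub>C x" by (intro scaleC.tendsto tendsto_const *(2))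
  moreover have "c *\<^sub>C f n \<in> M" for n using * assms complex_vector.subspace_scale by blast
  ultimately show "c *\<^sub>C x \<in> closure M"
    unfolding closure_sequential by (intro exI[of _ "\<lambda>n. c *\<^sub>C f n"]) simp
qed

text \<open>The vector joining a point outside M to its nearest point in M. A minimizing sequence is
  Cauchy by the parallelogram law, so completeness supplies the nearest point.\<close>

lemma orthogonal_vector_exists:
  assumes cl: "closed M" and sub: "complex_vector.subspace M" and ne: "M \<noteq> UNIV"
  obtains u :: "'a::chilbert_space" where "u \<noteq> 0" "\<And>m. m \<in> M \<Longrightarrow> cinner m u = 0"
proof -
  obtain v where v: "v \<notin> M" using ne by blast
  have M0: "0 \<in> M" using sub complex_vector.subspace_0 by blast
  define d where "d = infdist v M"
  have d0: "0 \<le> d" by (simp add: d_def infdist_nonneg)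
  have dle: "d \<le> norm (v - m)" if "m \<in> M" for m
    using infdist_le[OF that, of v] by (simp only: d_def dist_norm)
  have "\<exists>m\<in>M. norm (v - m) < d + 1 / real (Suc k)" for k
  proof (rule ccontr)
    assume "\<not> ?thesis"
    hence "\<And>m. m \<in> M \<Longrightarrow> d + 1 / real (Suc k) \<le> dist v m" by (auto simp: dist_norm)
    hence "d + 1 / real (Suc k) \<le> infdist v M"
      unfolding infdist_notempty[OF ex_in_conv[THEN iffD1, OF exI[of _ 0], OF M0]]
      by (intro cINF_greatest) (use M0 in auto)
    thus False by (simp add: d_def)
  qed
  then obtain f where f: "\<And>k. f k \<in> M" "\<And>k. norm (v - f k) < d + 1 / real (Suc k)" by metis
  have lim: "(\<lambda>k. norm (v - f k)) \<longlonglongrightarrow> d"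
  proof (rule real_tendsto_sandwich[where f = "\<lambda>_. d"])
    show "(\<lambda>k. d + 1 / real (Suc k)) \<longlonglongrightarrow> d"
      using tendsto_add[OF tendsto_const[of d] LIMSEQ_inverse_real_of_nat]
      by (simp add: inverse_eq_divide)
    show "\<forall>\<^sub>F k in sequentially. norm (v - f k) \<le> d + 1 / real (Suc k)"
      using f(2) by (intro always_eventually allI less_imp_le)
    show "\<forall>\<^sub>F k in sequentially. d \<le> norm (v - f k)"
      by (intro always_eventually allI dle f(1))
  qed (rule tendsto_const)
  \<comment> \<open>Parallelogram law for \<open>v - f j\<close> and \<open>v - f k\<close>; the
    midpoint of \<open>f j\<close> and \<open>f k\<close> lies in M, so the sum of the two vectors
    has length at least \<open>2 * d\<close>.\<close>
  have par: "(norm (f j - f k))\<^sup>2 \<le> 2 * (norm (v - f j))\<^sup>2 + 2 * (norm (v - f k))\<^sup>2 - 4 * d\<^sup>2" for j k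
  proof -
    have "(norm ((v - f j) + (v - f k)))\<^sup>2 + (norm ((v - f j) - (v - f k)))\<^sup>2
        = 2 * (norm (v - f j))\<^sup>2 + 2 * (norm (v - f k))\<^sup>2"
      unfolding norm_add_square norm_diff_square by simp
    moreover have "norm ((v - f j) - (v - f k)) = norm (f j - f k)"
      by (simp add: norm_minus_commute)
    moreover have "(2 * d)\<^sup>2 \<le> (norm ((v - f j) + (v - f k)))\<^sup>2"
    proof (rule power_mono)
      have "(1/2) *\<^sub>R (f j + f k) \<in> M"
        unfolding scaleR_scaleC using f(1) sub
        by (intro complex_vector.subspace_scale complex_vector.subspace_add)
      hence "d \<le> norm (v - (1/2) *\<^sub>R (f j + f k))" using dle by blast
      also have "v - (1/2) *\<^sub>R (f j + f k) = (1/2) *\<^sub>R ((v - f j) + (v - f k))"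
      proof -
        have "v = (1/2) *\<^sub>R (v + v)" by (simp add: scaleR_2[symmetric])
        hence "v - (1/2) *\<^sub>R (f j + f k) = (1/2) *\<^sub>R (v + v) - (1/2) *\<^sub>R (f j + f k)" by simp
        thus ?thesis by (simp add: scaleR_diff_right[symmetric] algebra_simps)
      qed
      finally show "2 * d \<le> norm ((v - f j) + (v - f k))" by simp
    qed (use d0 in simp)
    ultimately show ?thesis by (simp add: power_mult_distrib)
  qed
  have "Cauchy f"
  proof (rule metric_CauchyI)
    fix r :: real assume r: "0 < r"
    have "(\<lambda>k. (norm (v - f k))\<^sup>2) \<longlonglongrightarrow> d\<^sup>2" using lim tendsto_power by blast
    hence "\<forall>\<^sub>F k in sequentially. (norm (v - f k))\<^sup>2 < d\<^sup>2 + r\<^sup>2 / 4"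
      by (rule order_tendstoD) (use r in simp)
    then obtain N where N: "\<And>k. k \<ge> N \<Longrightarrow> (norm (v - f k))\<^sup>2 < d\<^sup>2 + r\<^sup>2 / 4"
      unfolding eventually_sequentially by blast
    have "dist (f j) (f k) < r" if "j \<ge> N" "k \<ge> N" for j k
    proof -
      have "(norm (f j - f k))\<^sup>2 < r\<^sup>2" using par[of j k] N[OF that(1)] N[OF that(2)] by linarith
      thus ?thesis using r by (simp add: dist_norm power_less_imp_less_base less_imp_le)
    qed
    thus "\<exists>N. \<forall>j\<ge>N. \<forall>k\<ge>N. dist (f j) (f k) < r" by blast
  qed
  then obtain m where m: "f \<longlonglongrightarrow> m" using Cauchy_convergent convergent_def by blast
  have mM: "m \<in> M" using closed_sequentially[OF cl] f(1) m by blast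
  define u where "u = v - m"
  have "(\<lambda>k. norm (v - f k)) \<longlonglongrightarrow> norm u" unfolding u_def by (intro tendsto_intros m)
  hence nu: "norm u = d" using lim LIMSEQ_unique by blast
  have "cinner x u = 0" if x: "x \<in> M" for x
  proof (cases "x = 0")
    case False
    define c where "c = cinner x u / (norm x)\<^sup>2"
    \<comment> \<open>Subtracting from u its component along x only moves the point m within M,
      hence cannot shorten u.\<close>
    have "m + c *\<^sub>C x \<in> M"
      using mM x sub by (intro complex_vector.subspace_scale complex_vector.subspace_add)
    hence "d \<le> norm (u - c *\<^sub>C x)" using dle[of "m + c *\<^sub>C x"] by (simp add: u_def algebra_simps)
    hence "d\<^sup>2 \<le> (norm (u - c *\<^sub>C x))\<^sup>2" using d0 power_mono by blast
    also have "\<dots> = d\<^sup>2 - (cmod (cinner x u) / norm x)\<^sup>2"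
      unfolding c_def norm_diff_projection[OF False] nu ..
    finally show ?thesis using False by simp
  qed (simp add: cinner.zero_left)
  moreover have "u \<noteq> 0" using v mM u_def by auto
  ultimately show ?thesis using that by blast
qed

section \<open>Bounded operators, representation of functionals, adjoints\<close>

lemma bounded_clinear_add: "bounded_clinear T \<Longrightarrow> T (x + y) = T x + T y"
  by (simp add: bounded_clinear_def bounded_linear.linear linear_add)
lemma bounded_clinear_diff: "bounded_clinear T \<Longrightarrow> T (x - y) = T x - T y"
  by (simp add: bounded_clinear_def bounded_linear.linear linear_diff)
lemma bounded_clinear_zero: "bounded_clinear T \<Longrightarrow> T 0 = 0"
  by (simp add: bounded_clinear_def bounded_linear.linear linear_0)
lemma bounded_clinear_sum: "bounded_clinear T \<Longrightarrow> T (\<Sum>i\<in>I. g i) = (\<Sum>i\<in>I. T (g i))"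
  by (simp add: bounded_clinear_def bounded_linear.linear linear_sum)
lemma bounded_clinear_scaleC: "bounded_clinear T \<Longrightarrow> T (c *\<^sub>C x) = c *\<^sub>C T x"
  by (simp add: bounded_clinear_def)

lemma bounded_clinearI:
  assumes "\<And>x y. T (x + y) = T x + T y" "\<And>c x. T (c *\<^sub>C x) = c *\<^sub>C T x"
    and "\<And>x. norm (T x) \<le> K * norm x"
  shows "bounded_clinear T"
  unfolding bounded_clinear_def
  using assms by (auto intro!: bounded_linear_intro[of T K] simp: scaleR_scaleC mult.commute)

text \<open>A functional is determined up to a scalar by its kernel, so a multiple of any nonzero
  vector orthogonal to the kernel represents it; evaluation at that vector fixes the
  multiple.\<close>

lemma riesz_representation:
  fixes \<phi> :: "'a::chilbert_space \<Rightarrow> complex"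
  assumes bl: "bounded_linear \<phi>" and hom: "\<And>c v. \<phi> (c *\<^sub>C v) = c * \<phi> v"
  obtains w where "\<And>v. \<phi> v = cinner w v"
proof (cases "\<forall>v. \<phi> v = 0")
  case True
  thus ?thesis using that[of 0] by (simp add: cinner.zero_left)
next
  case False
  interpret bounded_linear \<phi> by (rule bl)
  define M where "M = {v. \<phi> v = 0}"
  have "closed M" unfolding M_def
    by (intro closed_Collect_eq continuous_intros linear_continuous_on bl)
  moreover have "complex_vector.subspace M"
    by (rule complex_vector.subspaceI) (auto simp: M_def add zero hom)
  moreover have "M \<noteq> UNIV" using False by (auto simp: M_def)
  ultimately obtain u where u: "u \<noteq> 0" "\<And>m. m \<in> M \<Longrightarrow> cinner m u = 0"
    by (rule orthogonal_vector_exists) blast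
  define c where "c = \<phi> u / (norm u)\<^sup>2"
  have "\<phi> v = cinner (cnj c *\<^sub>C u) v" for v
  proof -
    have "\<phi> v *\<^sub>C u - \<phi> u *\<^sub>C v \<in> M" by (simp add: M_def diff hom)
    hence "cinner u (\<phi> v *\<^sub>C u - \<phi> u *\<^sub>C v) = 0" using u(2) cinner_zero_commute by blast
    hence "\<phi> v * (norm u)\<^sup>2 = \<phi> u * cinner u v" by (simp add: cinner_simps cinner_self)
    thus ?thesis using u(1) by (simp add: c_def cinner_simps field_simps)
  qed
  thus ?thesis by (rule that)
qed

lemma cadjoint:
  assumes T: "bounded_clinear T"
  shows "cinner (cadjoint T v) w = cinner v (T w)"
proof -
  have "\<exists>u. \<forall>w. cinner v (T w) = cinner u w" for v
  proof -
    have "bounded_linear (\<lambda>w. cinner v (T w))"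
      using T cinner.bounded_linear_right bounded_linear_compose unfolding bounded_clinear_def by blast
    thus ?thesis
      by (rule riesz_representation[of "\<lambda>w. cinner v (T w)"])
        (auto simp: bounded_clinear_scaleC[OF T] cinner_simps)
  qed
  then obtain S where S: "\<And>v w. cinner (S v) w = cinner v (T w)" by metis
  have "cadjoint T = S"
    unfolding cadjoint_def
  proof (rule the_equality)
    fix R assume R: "\<forall>v w. cinner (R v) w = cinner v (T w)"
    show "R = S"
      by (intro ext cinner_extensionality) (metis R S cinner_commute)
  qed (use S in blast)
  thus ?thesis using S by simp
qed

lemma cadjoint_right: "bounded_clinear T \<Longrightarrow> cinner w (cadjoint T v) = cinner (T w) v"
  by (metis cadjoint cinner_commute)

lemma bounded_clinear_bound:
  assumes "bounded_clinear T"
  obtains K where "0 \<le> K" "\<And>x. norm (T x) \<le> K * norm x"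
  using assms unfolding bounded_clinear_def
  by (metis bounded_linear.nonneg_bounded mult.commute)

lemma norm_cadjoint_le:
  assumes T: "bounded_clinear T" and K: "\<And>x. norm (T x) \<le> K * norm x"
  shows "norm (cadjoint T v) \<le> K * norm v"
proof (cases "cadjoint T v = 0")
  case True
  have "0 \<le> K * norm v" using K[of v] norm_ge_zero order_trans by blast
  thus ?thesis using True by simp
next
  case False
  have "(norm (cadjoint T v))\<^sup>2 = cmod (cinner (cadjoint T v) (cadjoint T v))"
    by (simp add: cinner_self norm_power)
  also have "\<dots> = cmod (cinner v (T (cadjoint T v)))" by (simp only: cadjoint[OF T])
  also have "\<dots> \<le> norm v * norm (T (cadjoint T v))" by (rule cauchy_schwarz)
  also have "\<dots> \<le> norm v * (K * norm (cadjoint T v))" by (intro mult_left_mono K) simp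
  finally show ?thesis using False by (simp add: power2_eq_square mult_ac)
qed

lemma bounded_clinear_cadjoint:
  assumes T: "bounded_clinear T"
  shows "bounded_clinear (cadjoint T)"
proof -
  obtain K where K: "\<And>x. norm (T x) \<le> K * norm x" by (rule bounded_clinear_bound[OF T]) blast
  show ?thesis
  proof (rule bounded_clinearI)
    show "norm (cadjoint T x) \<le> K * norm x" for x by (rule norm_cadjoint_le[OF T K])
    show "cadjoint T (x + y) = cadjoint T x + cadjoint T y" for x y
      by (rule cinner_extensionality) (simp add: cadjoint_right[OF T] cinner_simps)
    show "cadjoint T (c *\<^sub>C x) = c *\<^sub>C cadjoint T x" for c x
      by (rule cinner_extensionality) (simp add: cadjoint_right[OF T] cinner_simps)
  qed
qed

lemma bounded_clinear_continuous: "bounded_clinear T \<Longrightarrow> f \<longlonglongrightarrow> x \<Longrightarrow> (\<lambda>n. T (f n)) \<longlonglongrightarrow> T x"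
  unfolding bounded_clinear_def by (blast intro: bounded_linear.tendsto)

lemma bounded_clinear_sums: "bounded_clinear T \<Longrightarrow> f sums x \<Longrightarrow> (\<lambda>n. T (f n)) sums T x"
  unfolding bounded_clinear_def by (blast intro: bounded_linear.sums)

text \<open>\<open>op_trace\<close> selects its basis by \<open>SOME\<close>, so it can be computed
  only once a basis is known to exist. Zorn's lemma gives a maximal orthonormal set; were its closed
  span proper, a normalized vector orthogonal to it could be added.\<close>

lemma orthonormal_basis_exists: "\<exists>B :: 'a::chilbert_space set. orthonormal_basis B"
proof -
  define orth where "orth = (\<lambda>B :: 'a set. (\<forall>e\<in>B. norm e = 1) \<and> (\<forall>e\<in>B. \<forall>f\<in>B. e \<noteq> f \<longrightarrow> cinner e f = 0))"
  have "\<exists>B\<in>{B. orth B}. \<forall>C\<in>{B. orth B}. B \<subseteq> C \<longrightarrow> C = B"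
  proof (rule subset_Zorn')
    fix \<C> assume C: "subset.chain {B. orth B} \<C>"
    show "\<Union>\<C> \<in> {B. orth B}"
      unfolding orth_def
    proof (intro CollectI conjI ballI impI)
      fix e assume "e \<in> \<Union>\<C>"
      thus "norm e = 1" using C by (auto simp: subset_chain_def orth_def)
    next
      fix e f assume "e \<in> \<Union>\<C>" "f \<in> \<Union>\<C>" and ne: "e \<noteq> f"
      then obtain A B where "A \<in> \<C>" "e \<in> A" "B \<in> \<C>" "f \<in> B" by blast
      moreover from this have "A \<subseteq> B \<or> B \<subseteq> A" "orth A" "orth B"
        using C by (auto simp: subset_chain_def)
      ultimately show "cinner e f = 0" using ne unfolding orth_def by blast
    qed
  qed
  then obtain B where B: "orth B" and mx: "\<And>C. orth C \<Longrightarrow> B \<subseteq> C \<Longrightarrow> C = B" by blast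
  have "closure (cspan B) = UNIV"
  proof (rule ccontr)
    assume "closure (cspan B) \<noteq> UNIV"
    moreover have "complex_vector.subspace (closure (cspan B))"
      by (intro subspace_closure) (simp add: complex_vector.subspace_span)
    ultimately obtain u where u: "u \<noteq> 0" "\<And>m. m \<in> closure (cspan B) \<Longrightarrow> cinner m u = 0"
      using orthogonal_vector_exists[OF closed_closure, of "cspan B"] by blast
    define w where "w = complex_of_real (1 / norm u) *\<^sub>C u"
    have uB: "cinner b u = 0" if "b \<in> B" for b
      using u(2) that closure_subset complex_vector.span_base by blast
    have nw: "norm w = 1" using u(1) by (simp add: w_def norm_scaleC norm_divide)
    have wB: "cinner b w = 0" "cinner w b = 0" if "b \<in> B" for b
      using uB[OF that] cinner_zero_commute[of b u] by (simp_all add: w_def cinner_simps)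
    have "orth (insert w B)"
      using B wB nw unfolding orth_def by blast
    hence "w \<in> B" using mx by blast
    hence "cinner w w = 0" by (rule wB)
    thus False using nw by (simp add: cinner_self)
  qed
  hence "orthonormal_basis B" using B by (simp add: orth_def orthonormal_basis_def)
  thus ?thesis ..
qed

section \<open>Orthonormal systems and Bessel systems\<close>

text \<open>Zero vectors are admitted, so that finite systems can be padded.\<close>

definition ortho_system :: "(nat \<Rightarrow> 'a::chilbert_space) \<Rightarrow> bool" where
  "ortho_system e \<longleftrightarrow> (\<forall>m n. m \<noteq> n \<longrightarrow> cinner (e m) (e n) = 0) \<and> (\<forall>n. e n = 0 \<or> norm (e n) = 1)"

text \<open>Unlike orthogonality, Bessel's inequality survives contractions, which matters when
  phases are inserted into the diagonal of an operator.\<close>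

definition bessel :: "(nat \<Rightarrow> 'a::chilbert_space) \<Rightarrow> bool" where
  "bessel e \<longleftrightarrow> (\<forall>N v. (\<Sum>n<N. (cmod (cinner (e n) v))\<^sup>2) \<le> (norm v)\<^sup>2)"

text \<open>For an orthonormal system this is the projection onto the orthogonal complement of its
  first n vectors; zero vectors contribute nothing.\<close>

definition residual :: "(nat \<Rightarrow> 'a::chilbert_space) \<Rightarrow> nat \<Rightarrow> 'a \<Rightarrow> 'a" where
  "residual e n v = v - (\<Sum>k<n. cinner (e k) v *\<^sub>C e k)"

lemma ortho_system_norm_le: "ortho_system e \<Longrightarrow> norm (e n) \<le> 1"
  unfolding ortho_system_def by (metis norm_zero order_refl zero_le_one)

lemma residual_Suc: "residual e (Suc n) v = residual e n v - cinner (e n) v *\<^sub>C e n"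
  by (simp add: residual_def)

lemma bounded_clinear_residual: "bounded_clinear (residual e n)"
proof -
  have "bounded_linear (residual e n)"
    unfolding residual_def
    by (intro bounded_linear_sub bounded_linear_ident bounded_linear_sum
        bounded_linear_compose[OF scaleC.bounded_linear_left] cinner.bounded_linear_right)
  thus ?thesis
    unfolding bounded_clinear_def residual_def
    by (simp add: cinner_simps complex_vector.scale_right_diff_distrib complex_vector.scale_sum_right)
qed

lemma cinner_residual:
  assumes "ortho_system e"
  shows "cinner (e k) (residual e n v) = (if k < n then 0 else cinner (e k) v)"
proof -
  have "cinner (e k) (\<Sum>i<n. cinner (e i) v *\<^sub>C e i) = (\<Sum>i<n. if i = k then cinner (e k) v else 0)"
    unfolding cinner.sum_right
  proof (rule sum.cong)
    fix i
    have "cinner (e k) v * (norm (e k))\<^sup>2 = cinner (e k) v"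
      using assms by (cases "e k = 0") (auto simp: ortho_system_def cinner.zero_left)
    thus "cinner (e k) (cinner (e i) v *\<^sub>C e i) = (if i = k then cinner (e k) v else 0)"
      using assms by (auto simp: ortho_system_def cinner_simps cinner_self)
  qed simp
  thus ?thesis by (simp add: residual_def cinner_simps)
qed

lemma norm_residual:
  assumes "ortho_system e"
  shows "(norm (residual e n v))\<^sup>2 = (norm v)\<^sup>2 - (\<Sum>k<n. (cmod (cinner (e k) v))\<^sup>2)"
proof (induction n)
  case (Suc n)
  show ?case
  proof (cases "e n = 0")
    case False
    hence 1: "norm (e n) = 1" using assms by (auto simp: ortho_system_def)
    have "(norm (residual e (Suc n) v))\<^sup>2 = (norm (residual e n v))\<^sup>2 - (cmod (cinner (e n) v))\<^sup>2"
      using norm_diff_projection[OF False, of "residual e n v"]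
      by (simp add: residual_Suc cinner_residual[OF assms] 1)
    thus ?thesis using Suc by simp
  qed (use Suc in \<open>simp add: residual_Suc cinner.zero_left\<close>)
qed (simp add: residual_def)

lemma ortho_system_bessel: "ortho_system e \<Longrightarrow> bessel e"
  unfolding bessel_def using norm_residual[of e] by (metis diff_ge_0_iff_ge zero_le_power2)

lemma norm_residual_le:
  assumes "ortho_system e"
  shows "norm (residual e n v) \<le> norm v"
proof (rule power2_le_imp_le)
  show "(norm (residual e n v))\<^sup>2 \<le> (norm v)\<^sup>2"
    unfolding norm_residual[OF assms] by (simp add: sum_nonneg)
qed simp

lemma bessel_norm_le: 
  assumes "bessel e"
  shows "norm (e n) \<le> 1"
proof (cases "e n = 0")
  case False
  have "(cmod (cinner (e n) (e n)))\<^sup>2 \<le> (\<Sum>k<Suc n. (cmod (cinner (e k) (e n)))\<^sup>2)"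
    by (rule member_le_sum[of n "{..<Suc n}" "\<lambda>k. (cmod (cinner (e k) (e n)))\<^sup>2"]) auto
  also have "\<dots> \<le> (norm (e n))\<^sup>2" using assms unfolding bessel_def by blast
  finally have "(norm (e n))\<^sup>2 * (norm (e n))\<^sup>2 \<le> (norm (e n))\<^sup>2 * 1"
    by (simp add: cinner_self norm_power power2_eq_square norm_mult)
  hence "(norm (e n))\<^sup>2 \<le> 1" by (rule mult_left_le_imp_le) (use False in simp)
  thus ?thesis using power2_le_imp_le[of "norm (e n)" 1] by simp
qed simp

lemma bessel_summable:
  assumes "bessel e"
  shows "summable (\<lambda>n. (cmod (cinner (e n) v))\<^sup>2)"
  using assms unfolding bessel_def by (intro summableI_nonneg_bounded[of _ "(norm v)\<^sup>2"]) auto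

lemma bessel_suminf_le:
  assumes "bessel e"
  shows "(\<Sum>n. (cmod (cinner (e n) v))\<^sup>2) \<le> (norm v)\<^sup>2"
  using assms unfolding bessel_def by (intro suminf_le_const[OF bessel_summable[OF assms]]) auto

lemma bessel_shift:
  assumes "bessel e"
  shows "bessel (\<lambda>n. e (n + k))"
  unfolding bessel_def
proof (intro allI)
  fix N v
  have "(\<Sum>n<N. (cmod (cinner (e (n + k)) v))\<^sup>2) = (\<Sum>n\<in>(\<lambda>n. n + k) ` {..<N}. (cmod (cinner (e n) v))\<^sup>2)"
    by (subst sum.reindex) (auto simp: inj_on_def)
  also have "\<dots> \<le> (\<Sum>n<N + k. (cmod (cinner (e n) v))\<^sup>2)"
    by (rule sum_mono2) auto
  also have "\<dots> \<le> (norm v)\<^sup>2" using assms unfolding bessel_def by blast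
  finally show "(\<Sum>n<N. (cmod (cinner (e (n + k)) v))\<^sup>2) \<le> (norm v)\<^sup>2" .
qed

lemma norm_ortho_sum:
  assumes e: "ortho_system e" and "finite I"
  shows "(norm (\<Sum>n\<in>I. c n *\<^sub>C e n))\<^sup>2 = (\<Sum>n\<in>I. (cmod (c n))\<^sup>2 * (norm (e n))\<^sup>2)"
  using \<open>finite I\<close>
proof induction
  case (insert k I)
  have "cinner (c k *\<^sub>C e k) (\<Sum>n\<in>I. c n *\<^sub>C e n) = 0"
    unfolding cinner.sum_right
  proof (intro sum.neutral ballI)
    fix n assume "n \<in> I"
    hence "cinner (e k) (e n) = 0" using insert.hyps e unfolding ortho_system_def by metis
    thus "cinner (c k *\<^sub>C e k) (c n *\<^sub>C e n) = 0" by (simp add: cinner_simps)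
  qed
  thus ?case using insert by (simp add: norm_add_square norm_scaleC power_mult_distrib)
qed simp

text \<open>Riesz-Fischer: by Pythagoras the blocks of the vector series are bounded by the blocks
  of a convergent series of squares, so the partial sums are Cauchy.\<close>

lemma ortho_summable:
  assumes e: "ortho_system e" and c: "summable (\<lambda>n. (cmod (c n))\<^sup>2)"
  shows "summable (\<lambda>n. c n *\<^sub>C e n)"
  unfolding summable_Cauchy
proof (intro allI impI)
  fix r :: real assume r: "0 < r"
  obtain N where N: "\<And>m n. m \<ge> N \<Longrightarrow> norm (\<Sum>k\<in>{m..<n}. (cmod (c k))\<^sup>2) < r\<^sup>2"
    using c r unfolding summable_Cauchy by (meson zero_less_power)
  have "norm (\<Sum>k\<in>{m..<n}. c k *\<^sub>C e k) < r" if "m \<ge> N" for m n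
  proof -
    have "(norm (\<Sum>k\<in>{m..<n}. c k *\<^sub>C e k))\<^sup>2 \<le> (\<Sum>k\<in>{m..<n}. (cmod (c k))\<^sup>2)"
      unfolding norm_ortho_sum[OF e finite_atLeastLessThan]
      using ortho_system_norm_le[OF e]
      by (intro sum_mono mult_left_le) (auto simp: power_le_one)
    also have "\<dots> < r\<^sup>2" using N[OF that, of n] by (simp add: abs_of_nonneg sum_nonneg)
    finally show ?thesis using r by (simp add: power_less_imp_less_base less_imp_le)
  qed
  thus "\<exists>N. \<forall>m\<ge>N. \<forall>n. norm (\<Sum>k\<in>{m..<n}. c k *\<^sub>C e k) < r" by blast
qed

lemma norm_ortho_sums:
  assumes e: "ortho_system e" and x: "(\<lambda>n. c n *\<^sub>C e n) sums x"
  shows "(\<lambda>n. (cmod (c n))\<^sup>2 * (norm (e n))\<^sup>2) sums (norm x)\<^sup>2"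
proof -
  have "(\<lambda>N. (norm (\<Sum>n<N. c n *\<^sub>C e n))\<^sup>2) \<longlonglongrightarrow> (norm x)\<^sup>2"
    using x unfolding sums_def by (intro tendsto_intros)
  thus ?thesis unfolding sums_def norm_ortho_sum[OF e finite_lessThan] .
qed

lemma cinner_ortho_sums:
  assumes e: "ortho_system e" and x: "(\<lambda>n. c n *\<^sub>C e n) sums x"
  shows "cinner (e k) x = c k * (norm (e k))\<^sup>2"
proof -
  have "(\<lambda>n. cinner (e k) (c n *\<^sub>C e n)) sums cinner (e k) x"
    by (rule bounded_linear.sums[OF cinner.bounded_linear_right x])
  moreover have "(\<lambda>n. cinner (e k) (c n *\<^sub>C e n)) = (\<lambda>n. if n = k then c n * (norm (e n))\<^sup>2 else 0)"
    using e by (auto simp: cinner_simps cinner_self ortho_system_def)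
  ultimately have "(\<lambda>n. if n = k then c n * (norm (e n))\<^sup>2 else 0) sums cinner (e k) x" by simp
  thus ?thesis using sums_single[of k "\<lambda>n. c n * complex_of_real ((norm (e n))\<^sup>2)"] sums_unique2 by blast
qed

section \<open>Operators given by series of rank-one operators\<close>

definition series_op :: "(nat \<Rightarrow> complex) \<Rightarrow> (nat \<Rightarrow> 'a::chilbert_space) \<Rightarrow> (nat \<Rightarrow> 'a) \<Rightarrow> 'a \<Rightarrow> 'a" where
  "series_op c e f v = (\<Sum>n. (c n * cinner (e n) v) *\<^sub>C f n)"

lemma
  assumes e: "bessel e" and f: "ortho_system f" and K: "\<And>n. cmod (c n) \<le> K"
  shows series_op_sums: "(\<lambda>n. (c n * cinner (e n) v) *\<^sub>C f n) sums series_op c e f v"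
    and bounded_clinear_series_op: "bounded_clinear (series_op c e f)"
proof -
  have K0: "0 \<le> K" using K[of 0] norm_ge_zero order_trans by blast
  have le: "(cmod (c n * cinner (e n) v))\<^sup>2 \<le> K\<^sup>2 * (cmod (cinner (e n) v))\<^sup>2" for n v
    unfolding norm_mult power_mult_distrib by (intro mult_right_mono power_mono K) auto
  have "summable (\<lambda>n. (cmod (c n * cinner (e n) v))\<^sup>2)" for v
    by (rule summable_comparison_test'[OF summable_mult[OF bessel_summable[OF e], of "K\<^sup>2"], of 0])
      (use le in auto)
  hence sm: "(\<lambda>n. (c n * cinner (e n) v) *\<^sub>C f n) sums series_op c e f v" for v
    unfolding series_op_def by (intro summable_sums ortho_summable[OF f])
  have nb: "norm (series_op c e f v) \<le> K * norm v" for v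
  proof (rule power2_le_imp_le)
    have "(norm (series_op c e f v))\<^sup>2 = (\<Sum>n. (cmod (c n * cinner (e n) v))\<^sup>2 * (norm (f n))\<^sup>2)"
      by (rule sums_unique[OF norm_ortho_sums[OF f sm]])
    also have "\<dots> \<le> (\<Sum>n. K\<^sup>2 * (cmod (cinner (e n) v))\<^sup>2)"
    proof (rule suminf_le)
      fix n
      have "(norm (f n))\<^sup>2 \<le> 1" using ortho_system_norm_le[OF f] by (simp add: power_le_one)
      hence "(cmod (c n * cinner (e n) v))\<^sup>2 * (norm (f n))\<^sup>2 \<le> (cmod (c n * cinner (e n) v))\<^sup>2"
        by (intro mult_left_le) auto
      thus "(cmod (c n * cinner (e n) v))\<^sup>2 * (norm (f n))\<^sup>2 \<le> K\<^sup>2 * (cmod (cinner (e n) v))\<^sup>2"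
        using le order_trans by blast
    next
      show "summable (\<lambda>n. (cmod (c n * cinner (e n) v))\<^sup>2 * (norm (f n))\<^sup>2)"
        using norm_ortho_sums[OF f sm] by (rule sums_summable)
    qed (rule summable_mult[OF bessel_summable[OF e]])
    also have "\<dots> \<le> K\<^sup>2 * (norm v)\<^sup>2"
      unfolding suminf_mult[OF bessel_summable[OF e]]
      by (intro mult_left_mono bessel_suminf_le[OF e]) auto
    finally show "(norm (series_op c e f v))\<^sup>2 \<le> (K * norm v)\<^sup>2" by (simp add: power_mult_distrib)
  qed (use K0 in simp)
  show "(\<lambda>n. (c n * cinner (e n) v) *\<^sub>C f n) sums series_op c e f v" by (rule sm)
  show "bounded_clinear (series_op c e f)"
  proof (rule bounded_clinearI[where K = K])
    fix x y
    show "series_op c e f (x + y) = series_op c e f x + series_op c e f y"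
      using sums_unique2[OF sm[of "x + y"]] sums_add[OF sm[of x] sm[of y]]
      by (simp add: cinner_simps distrib_left scaleC_add_left)
  next
    fix a x
    have "(\<lambda>n. a *\<^sub>C (c n * cinner (e n) x) *\<^sub>C f n) sums (a *\<^sub>C series_op c e f x)"
      by (rule bounded_linear.sums[OF scaleC.bounded_linear_right sm])
    thus "series_op c e f (a *\<^sub>C x) = a *\<^sub>C series_op c e f x"
      using sums_unique2[OF sm[of "a *\<^sub>C x"]] by (simp add: cinner_simps scaleC_scaleC mult_ac)
  qed (rule nb)
qed

lemma ortho_decomposition:
  assumes e: "ortho_system e"
  obtains x r where "v = x + r" "(\<lambda>n. cinner (e n) v *\<^sub>C e n) sums x" "\<And>n. cinner (e n) r = 0"
proof -
  define x where "x = series_op (\<lambda>_. 1) e e v"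
  have x: "(\<lambda>n. cinner (e n) v *\<^sub>C e n) sums x"
    using series_op_sums[OF ortho_system_bessel[OF e] e, of "\<lambda>_. 1" 1 v] by (simp add: x_def)
  have "cinner (e n) (v - x) = 0" for n
  proof -
    have "e n = 0 \<or> norm (e n) = 1" using e by (auto simp: ortho_system_def)
    thus ?thesis using cinner_ortho_sums[OF e x, of n] by (auto simp: cinner_simps cinner.zero_left)
  qed
  thus ?thesis using that[of x "v - x"] x by simp
qed

text \<open>Extensionality for operators: continuity extends agreement on the system to convergent
  series, and the remaining component is orthogonal to the system. The identification of operators
  with explicit diagonal forms rests on it.\<close>

lemma bounded_clinear_eqI:
  assumes e: "ortho_system e" and S: "bounded_clinear S" and T: "bounded_clinear T"
    and eq: "\<And>n. S (e n) = T (e n)" and orth: "\<And>v. (\<And>n. cinner (e n) v = 0) \<Longrightarrow> S v = T v"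
  shows "S = T"
proof
  fix v
  obtain x r where v: "v = x + r" "(\<lambda>n. cinner (e n) v *\<^sub>C e n) sums x" "\<And>n. cinner (e n) r = 0"
    by (rule ortho_decomposition[OF e, of v]) blast
  have "S x = T x"
    using bounded_clinear_sums[OF S v(2)] bounded_clinear_sums[OF T v(2)]
    by (simp add: bounded_clinear_scaleC[OF S] bounded_clinear_scaleC[OF T] eq sums_unique2)
  thus "S v = T v" by (simp add: v(1) bounded_clinear_add S T orth v(3))
qed

section \<open>Singular value decomposition\<close>

text \<open>Unit vectors nearly maximizing \<open>norm (A x)\<close> are approximate eigenvectors of \<open>A\<^sup>*A\<close>; no weak
  compactness is needed to find a maximizer.\<close>

lemma norm_gram_diff_le:
  assumes A: "bounded_clinear A" and le: "\<And>v. norm (A v) \<le> \<sigma> * norm v" and x: "norm x = 1" and s: "0 \<le> \<sigma>"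
  shows "(norm (cadjoint A (A x) - complex_of_real (\<sigma>\<^sup>2) *\<^sub>C x))\<^sup>2 \<le> \<sigma>\<^sup>2 * (\<sigma>\<^sup>2 - (norm (A x))\<^sup>2)"
proof -
  have 1: "norm (cadjoint A (A x)) \<le> \<sigma> * norm (A x)" by (rule norm_cadjoint_le[OF A le])
  have 2: "cinner (cadjoint A (A x)) x = (norm (A x))\<^sup>2" by (simp add: cadjoint[OF A] cinner_self)
  have "(norm (cadjoint A (A x) - complex_of_real (\<sigma>\<^sup>2) *\<^sub>C x))\<^sup>2
      = (norm (cadjoint A (A x)))\<^sup>2 + (\<sigma>\<^sup>2)\<^sup>2 - 2 * \<sigma>\<^sup>2 * (norm (A x))\<^sup>2"
    unfolding norm_diff_square cinner_scaleC_right 2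
    by (simp add: norm_scaleC x norm_power s flip: of_real_power of_real_mult)
  also have "(norm (cadjoint A (A x)))\<^sup>2 \<le> (\<sigma> * norm (A x))\<^sup>2" by (intro power_mono 1) simp
  finally show ?thesis by (simp add: power_mult_distrib algebra_simps power2_eq_square)
qed

text \<open>Compactness makes \<open>A (x k)\<close> converge along a subsequence. As
  \<open>cadjoint A (A (x k))\<close> and \<sigma>^2 times \<open>x k\<close> differ by a null
  sequence, \<open>x k\<close> converges along it as well. The set K is kept apart from A so that it
  can be the same for all deflations of one operator.\<close>

lemma gram_eigenvector:
  assumes A: "bounded_clinear A" and K: "compact K" "A ` cball 0 1 \<subseteq> K" and nz: "A v0 \<noteq> 0"
  obtains e \<sigma> where "norm e = 1" "0 < \<sigma>" "cadjoint A (A e) = complex_of_real (\<sigma>\<^sup>2) *\<^sub>C e"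
    "\<And>v. norm (A v) \<le> \<sigma> * norm v"
proof -
  have bl: "bounded_linear A" using A by (simp add: bounded_clinear_def)
  define \<sigma> where "\<sigma> = onorm A"
  have le: "norm (A v) \<le> \<sigma> * norm v" for v unfolding \<sigma>_def by (rule onorm[OF bl])
  have s: "0 < \<sigma>" unfolding \<sigma>_def using onorm_pos_lt[OF bl] nz by blast
  have "\<exists>x. norm x = 1 \<and> \<sigma> - 1 / real (Suc k) < norm (A x)" for k
  proof (rule ccontr)
    assume neg: "\<not> ?thesis"
    have b: "norm (A v) \<le> (\<sigma> - 1 / real (Suc k)) * norm v" for v
    proof (cases "v = 0")
      case False
      define x where "x = (1 / norm v) *\<^sub>R v"
      have "norm x = 1" using False by (simp add: x_def)
      hence "norm (A x) \<le> \<sigma> - 1 / real (Suc k)" using neg by force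
      moreover have "norm (A x) = norm (A v) / norm v"
        by (simp add: x_def linear_scale[OF bounded_linear.linear[OF bl]])
      ultimately show ?thesis using False by (simp add: pos_divide_le_eq)
    qed (simp add: bounded_clinear_zero[OF A])
    have "0 < (\<sigma> - 1 / real (Suc k)) * norm v0" using b[of v0] nz by (meson less_le_trans zero_less_norm_iff)
    hence "0 \<le> \<sigma> - 1 / real (Suc k)" by (simp add: zero_less_mult_iff)
    hence "onorm A \<le> \<sigma> - 1 / real (Suc k)" using b by (rule onorm_bound)
    thus False by (simp add: \<sigma>_def)
  qed
  then obtain x where x: "\<And>k. norm (x k) = 1" "\<And>k. \<sigma> - 1 / real (Suc k) < norm (A (x k))" by metis
  have "(\<lambda>k. norm (A (x k))) \<longlonglongrightarrow> \<sigma>"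
  proof (rule real_tendsto_sandwich[where h = "\<lambda>_. \<sigma>" and f = "\<lambda>k. \<sigma> - 1 / real (Suc k)"])
    show "(\<lambda>k. \<sigma> - 1 / real (Suc k)) \<longlonglongrightarrow> \<sigma>"
      using tendsto_diff[OF tendsto_const[of \<sigma>] LIMSEQ_inverse_real_of_nat] by (simp add: inverse_eq_divide)
    show "\<forall>\<^sub>F k in sequentially. norm (A (x k)) \<le> \<sigma>" using le[of "x _"] x(1) by simp
    show "\<forall>\<^sub>F k in sequentially. \<sigma> - 1 / real (Suc k) \<le> norm (A (x k))"
      by (intro always_eventually allI less_imp_le x(2))
  qed simp
  hence "(\<lambda>k. \<sigma>\<^sup>2 * (\<sigma>\<^sup>2 - (norm (A (x k)))\<^sup>2)) \<longlonglongrightarrow> \<sigma>\<^sup>2 * (\<sigma>\<^sup>2 - \<sigma>\<^sup>2)" by (intro tendsto_intros)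
  hence ub: "(\<lambda>k. \<sigma>\<^sup>2 * (\<sigma>\<^sup>2 - (norm (A (x k)))\<^sup>2)) \<longlonglongrightarrow> 0" by simp
  define g where "g = (\<lambda>k. cadjoint A (A (x k)) - complex_of_real (\<sigma>\<^sup>2) *\<^sub>C x k)"
  have "(\<lambda>k. (norm (g k))\<^sup>2) \<longlonglongrightarrow> 0"
    by (rule tendsto_sandwich[OF _ _ tendsto_const ub])
      (use norm_gram_diff_le[OF A le x(1)] s in \<open>auto simp: g_def intro!: always_eventually\<close>)
  hence "(\<lambda>k. sqrt ((norm (g k))\<^sup>2)) \<longlonglongrightarrow> sqrt 0" by (rule tendsto_real_sqrt)
  hence g0: "g \<longlonglongrightarrow> 0" by (simp add: tendsto_norm_zero_iff)
  have "A (x k) \<in> K" for k using K(2) x(1) by (auto simp: image_subset_iff)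
  then obtain y r where r: "strict_mono r" "((\<lambda>k. A (x k)) \<circ> r) \<longlonglongrightarrow> y"
    using K(1) unfolding compact_def by metis
  have gr: "(\<lambda>k. g (r k)) \<longlonglongrightarrow> 0" using LIMSEQ_subseq_LIMSEQ[OF g0 r(1)] by (simp add: o_def)
  define e where "e = complex_of_real (1 / \<sigma>\<^sup>2) *\<^sub>C cadjoint A y"
  have "(\<lambda>k. complex_of_real (1 / \<sigma>\<^sup>2) *\<^sub>C (cadjoint A (A (x (r k))) - g (r k)))
      \<longlonglongrightarrow> complex_of_real (1 / \<sigma>\<^sup>2) *\<^sub>C (cadjoint A y - 0)"
    using r(2) gr
    by (intro scaleC.tendsto tendsto_const tendsto_diff bounded_clinear_continuous[OF bounded_clinear_cadjoint[OF A]])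
      (simp_all add: o_def)
  moreover have "complex_of_real (1 / \<sigma>\<^sup>2) *\<^sub>C (cadjoint A (A (x (r k))) - g (r k)) = x (r k)" for k
    using s by (simp add: g_def scaleC_scaleC scaleC_one)
  ultimately have xe: "(\<lambda>k. x (r k)) \<longlonglongrightarrow> e" by (simp add: e_def)
  have ne: "norm e = 1"
    using tendsto_norm[OF xe] x(1) by (simp add: LIMSEQ_const_iff)
  have "(\<lambda>k. g (r k)) \<longlonglongrightarrow> cadjoint A (A e) - complex_of_real (\<sigma>\<^sup>2) *\<^sub>C e"
    unfolding g_def
    by (intro tendsto_diff scaleC.tendsto tendsto_const xe
        bounded_clinear_continuous[OF bounded_clinear_cadjoint[OF A]] bounded_clinear_continuous[OF A])
  hence "cadjoint A (A e) = complex_of_real (\<sigma>\<^sup>2) *\<^sub>C e" using gr LIMSEQ_unique by fastforce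
  thus ?thesis using that ne s le by blast
qed

text \<open>Only the right singular vectors are stored, as eigenvectors of X*X; the left ones are
  recovered from X. No vector of the kernel is included, so an exhausted sequence continues with
  zero vectors and zero values, which covers finite rank. The last conjunct says that nothing of X
  is missed.\<close>

definition svd :: "('a::chilbert_space \<Rightarrow> 'a) \<Rightarrow> (nat \<Rightarrow> real) \<Rightarrow> (nat \<Rightarrow> 'a) \<Rightarrow> bool" where
  "svd X s e \<longleftrightarrow> bounded_clinear X \<and> decseq s \<and> s \<longlonglongrightarrow> 0 \<and> ortho_system e \<and> (\<forall>n. e n = 0 \<longleftrightarrow> s n = 0) \<and>
     (\<forall>n. cadjoint X (X (e n)) = complex_of_real ((s n)\<^sup>2) *\<^sub>C e n) \<and>
     (\<forall>v. (\<forall>n. cinner (e n) v = 0) \<longrightarrow> X v = 0)"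

text \<open>Deflation: the eigenvector lemma is applied to X on the orthogonal complement of the
  first n vectors. Because these are eigenvectors of X*X, the complement is invariant under X*X, and
  an eigenvector of the deflated Gram operator is one of X*X itself.\<close>

lemma svd_step:
  assumes X: "compact_op X" and e: "ortho_system e"
    and eig: "\<And>k. k < n \<Longrightarrow> \<exists>c. cadjoint X (X (e k)) = c *\<^sub>C e k"
  obtains u \<sigma> where "0 \<le> \<sigma>" "u = 0 \<or> norm u = 1" "u = 0 \<longleftrightarrow> \<sigma> = 0" "\<And>k. k < n \<Longrightarrow> cinner (e k) u = 0"
    "cadjoint X (X u) = complex_of_real (\<sigma>\<^sup>2) *\<^sub>C u" "\<And>v. norm (X (residual e n v)) \<le> \<sigma> * norm v"
proof -
  have bX: "bounded_clinear X" using X by (simp add: compact_op_def)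
  define A where "A = (\<lambda>v. X (residual e n v))"
  have A: "bounded_clinear A"
    using bX bounded_clinear_residual[of e n] unfolding A_def bounded_clinear_def
    by (auto intro: bounded_linear_compose)
  show ?thesis
  proof (cases "\<forall>v. A v = 0")
    case True
    thus ?thesis
      using that[of 0 0] by (simp add: A_def cinner.zero_right bounded_clinear_zero bX bounded_clinear_cadjoint)
  next
    case False
    then obtain v0 where v0: "A v0 \<noteq> 0" by blast
    have "A ` cball 0 1 \<subseteq> X ` cball 0 1"
      unfolding A_def using norm_residual_le[OF e] order_trans by (fastforce simp: image_subset_iff)
    hence "A ` cball 0 1 \<subseteq> closure (X ` cball 0 1)" using closure_subset by blast
    moreover have "compact (closure (X ` cball 0 1))" using X by (simp add: compact_op_def)
    ultimately obtain u \<sigma> where u: "norm u = 1" "0 < \<sigma>" "cadjoint A (A u) = complex_of_real (\<sigma>\<^sup>2) *\<^sub>C u"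
      "\<And>v. norm (A v) \<le> \<sigma> * norm v"
      using gram_eigenvector[OF A _ _ v0] by blast
    have orth: "cinner (e k) u = 0" if k: "k < n" for k
    proof -
      have "residual e n (e k) = 0"
      proof -
        have "cinner (e i) (e k) *\<^sub>C e i = (if i = k then e k else 0)" for i
          using e by (auto simp: ortho_system_def cinner_self scaleC_one dest: spec[of _ k])
        thus ?thesis using k by (simp add: residual_def)
      qed
      hence "A (e k) = 0" by (simp add: A_def bounded_clinear_zero bX)
      \<comment> \<open>The range of the adjoint of A is orthogonal to the kernel of A, which
        contains \<open>e k\<close>.\<close>
      hence "cinner (e k) (cadjoint A (A u)) = 0" by (simp add: cadjoint_right[OF A] cinner.zero_left)
      thus ?thesis using u(2,3) by (simp add: cinner_simps)
    qed
    hence ru: "residual e n u = u" by (simp add: residual_def)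
    have "cadjoint X (X u) = complex_of_real (\<sigma>\<^sup>2) *\<^sub>C u"
    proof (rule cinner_extensionality)
      fix w
      have "X (residual e n w + (\<Sum>k<n. cinner (e k) w *\<^sub>C e k)) = A w + (\<Sum>k<n. cinner (e k) w *\<^sub>C X (e k))"
        by (simp add: A_def bounded_clinear_add[OF bX] bounded_clinear_sum[OF bX] bounded_clinear_scaleC[OF bX])
      hence "X w = A w + (\<Sum>k<n. cinner (e k) w *\<^sub>C X (e k))" by (simp add: residual_def)
      \<comment> \<open>X maps an eigenvector of X*X and a vector orthogonal to it to orthogonal
        vectors, so the first n components of w contribute nothing against
        \<open>X u\<close>.\<close>
      moreover have "cinner (X (e k)) (X u) = 0" if k: "k < n" for k
      proof -
        obtain c where c: "cadjoint X (X (e k)) = c *\<^sub>C e k" using eig[OF k] by blast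
        have "cinner (X (e k)) (X u) = cinner (cadjoint X (X (e k))) u" by (simp add: cadjoint[OF bX])
        thus ?thesis using orth[OF k] by (simp add: c cinner_simps)
      qed
      ultimately have "cinner (X w) (X u) = cinner (A w) (X u)"
        by (simp add: cinner_simps cinner.sum_left)
      also have "\<dots> = cinner (A w) (A u)" by (simp add: A_def ru)
      also have "\<dots> = cinner w (complex_of_real (\<sigma>\<^sup>2) *\<^sub>C u)" by (simp only: cadjoint_right[OF A, symmetric] u(3))
      finally show "cinner w (cadjoint X (X u)) = cinner w (complex_of_real (\<sigma>\<^sup>2) *\<^sub>C u)"
        by (simp only: cadjoint_right[OF bX])
    qed
    moreover have "u \<noteq> 0" using u(1) by force
    ultimately show ?thesis using that[of \<sigma> u] u orth by (simp add: A_def)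
  qed
qed

lemma cadjoint_gram_norm:
  assumes X: "bounded_clinear X" and "cadjoint X (X u) = complex_of_real (\<sigma>\<^sup>2) *\<^sub>C u" "0 \<le> \<sigma>"
  shows "norm (X u) = \<sigma> * norm u"
proof -
  have "complex_of_real ((norm (X u))\<^sup>2) = cinner u (cadjoint X (X u))"
    by (simp add: cadjoint_right[OF X] cinner_self)
  also have "\<dots> = complex_of_real ((\<sigma> * norm u)\<^sup>2)"
    by (simp add: assms(2) cinner_simps cinner_self power_mult_distrib)
  finally have "(norm (X u))\<^sup>2 = (\<sigma> * norm u)\<^sup>2" using of_real_eq_iff by blast
  thus ?thesis using assms(3) by (simp add: power2_eq_iff_nonneg)
qed

lemma compact_op_svd:
  assumes X: "compact_op X"
  obtains s e where "svd X s e"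
proof -
  have bX: "bounded_clinear X" using X by (simp add: compact_op_def)
  \<comment> \<open>\<open>P e n u\<close> says that u continues the first n vectors of e; it
    depends on these alone, as dependent choice requires. The value \<sigma> is hidden in it and
    recovered later as \<open>norm (X (e n))\<close>.\<close>
  define P where "P = (\<lambda>e n u. (u = 0 \<or> norm u = 1) \<and> (\<forall>k<n. cinner (e k) u = 0) \<and>
     (\<exists>\<sigma>\<ge>0. (u = 0 \<longleftrightarrow> \<sigma> = 0) \<and> cadjoint X (X u) = complex_of_real (\<sigma>\<^sup>2) *\<^sub>C u \<and>
       (\<forall>v. norm (X (residual e n v)) \<le> \<sigma> * norm v)))"
  have "\<exists>e. \<forall>n. P e n (e n)"
  proof (rule dependent_wellorder_choice)
    fix u n and f g :: "nat \<Rightarrow> 'a" assume eq: "\<And>k. k < n \<Longrightarrow> f k = g k"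
    hence "residual f n v = residual g n v" for v by (simp add: residual_def)
    thus "P f n u = P g n u" using eq by (simp add: P_def)
  next
    fix n and f :: "nat \<Rightarrow> 'a" assume *: "\<And>k. k < n \<Longrightarrow> P f k (f k)"
    \<comment> \<open>Padding with zeros turns the finite initial segment into a system to which the
      deflation step applies.\<close>
    define f' where "f' = (\<lambda>k. if k < n then f k else 0)"
    have orth: "cinner (f i) (f j) = 0" if "i < j" "j < n" for i j
      using *[OF that(2)] that(1) by (auto simp: P_def)
    have orth': "cinner (f i) (f j) = 0" if "i \<noteq> j" "i < n" "j < n" for i j
      using that orth[of i j] orth[of j i] cinner_zero_commute[of "f i" "f j"] by linarith
    have ortho: "ortho_system f'"
      unfolding ortho_system_def f'_def
      using * orth' by (auto simp: cinner.zero_left cinner.zero_right P_def)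
    have eig: "\<exists>c. cadjoint X (X (f' k)) = c *\<^sub>C f' k" if "k < n" for k
      using *[OF that] that by (auto simp: P_def f'_def)
    have res: "residual f' n = residual f n" by (auto simp: residual_def f'_def)
    obtain u \<sigma> where u: "0 \<le> \<sigma>" "u = 0 \<or> norm u = 1" "u = 0 \<longleftrightarrow> \<sigma> = 0" "\<And>k. k < n \<Longrightarrow> cinner (f' k) u = 0"
      "cadjoint X (X u) = complex_of_real (\<sigma>\<^sup>2) *\<^sub>C u" "\<And>v. norm (X (residual f' n v)) \<le> \<sigma> * norm v"
      by (rule svd_step[OF X ortho eig, of n]) blast+
    have "\<forall>k<n. cinner (f k) u = 0" using u(4) by (simp add: f'_def)
    hence "P f n u" unfolding P_def using u res by auto
    thus "\<exists>r. P f n r" ..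
  qed
  then obtain e where e: "\<And>n. P e n (e n)" by blast
  define s where "s = (\<lambda>n. norm (X (e n)))"
  have ortho: "ortho_system e"
  proof -
    have "cinner (e i) (e j) = 0" if "i \<noteq> j" for i j
      using e[of i] e[of j] that cinner_zero_commute[of "e i" "e j"] by (cases "i < j") (auto simp: P_def)
    thus ?thesis using e by (auto simp: ortho_system_def P_def)
  qed
  have main: "(e n = 0 \<longleftrightarrow> s n = 0) \<and> cadjoint X (X (e n)) = complex_of_real ((s n)\<^sup>2) *\<^sub>C e n \<and>
     (\<forall>v. norm (X (residual e n v)) \<le> s n * norm v)" for n
  proof -
    from e[of n] obtain \<sigma> where sg: "\<sigma> \<ge> 0" "e n = 0 \<longleftrightarrow> \<sigma> = 0"
      "cadjoint X (X (e n)) = complex_of_real (\<sigma>\<^sup>2) *\<^sub>C e n" "\<forall>v. norm (X (residual e n v)) \<le> \<sigma> * norm v"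
      "e n = 0 \<or> norm (e n) = 1"
      by (auto simp: P_def)
    have "s n = \<sigma> * norm (e n)" unfolding s_def by (rule cadjoint_gram_norm[OF bX sg(3,1)])
    hence "s n = \<sigma>" using sg(2,5) by auto
    thus ?thesis using sg by simp
  qed
  \<comment> \<open>Later vectors lie in every earlier complement, so the n-th bound applies to
    \<open>e (Suc n)\<close>; this gives monotonicity.\<close>
  have res: "residual e n (e m) = e m" if "n \<le> m" for n m
    using ortho that by (simp add: residual_def ortho_system_def)
  have s0: "0 \<le> s n" for n by (simp add: s_def)
  have dec: "decseq s"
  proof (rule decseq_SucI)
    fix n
    have "norm (X (residual e n (e (Suc n)))) \<le> s n * norm (e (Suc n))" using main by blast
    also have "\<dots> \<le> s n" by (intro mult_left_le ortho_system_norm_le[OF ortho] s0)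
    finally show "s (Suc n) \<le> s n" by (simp add: res s_def)
  qed
  have lim: "s \<longlonglongrightarrow> 0"
  proof -
    obtain L where L: "s \<longlonglongrightarrow> L" "\<And>n. L \<le> s n" using decseq_convergent[OF dec, of 0] s0 by blast
    have L0: "0 \<le> L" using L(1) s0 by (intro LIMSEQ_le_const) auto
    \<comment> \<open>Otherwise the vectors \<open>X (e n)\<close> would be pairwise orthogonal of
      norm at least L, hence at distance at least L from each other, and no subsequence could
      converge.\<close>
    have "L = 0"
    proof (rule ccontr)
      assume "L \<noteq> 0"
      hence Lp: "0 < L" using L0 by simp
      have "X (e n) \<in> closure (X ` cball 0 1)" for n
        using closure_subset[of "X ` cball 0 1"] ortho_system_norm_le[OF ortho] by auto
      moreover have "compact (closure (X ` cball 0 1))" using X by (simp add: compact_op_def)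
      ultimately obtain y r where r: "strict_mono r" "((\<lambda>n. X (e n)) \<circ> r) \<longlonglongrightarrow> y"
        unfolding compact_def by metis
      hence "Cauchy ((\<lambda>n. X (e n)) \<circ> r)" using LIMSEQ_imp_Cauchy by blast
      then obtain N where N: "\<And>m n. m \<ge> N \<Longrightarrow> n \<ge> N \<Longrightarrow> dist (X (e (r m))) (X (e (r n))) < L"
        using metric_CauchyD[OF _ Lp] by (metis comp_apply)
      define i j where "i = r N" and "j = r (Suc N)"
      have ij: "i \<noteq> j" unfolding i_def j_def using r(1) strict_mono_eq by fastforce
      have "cinner (X (e i)) (X (e j)) = cinner (e i) (cadjoint X (X (e j)))"
        by (simp add: cadjoint_right[OF bX])
      also have "\<dots> = 0" using main[of j] ij ortho by (simp add: cinner_simps ortho_system_def)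
      finally have "(norm (X (e i) - X (e j)))\<^sup>2 = (s i)\<^sup>2 + (s j)\<^sup>2" by (simp add: norm_diff_square s_def)
      moreover have "L\<^sup>2 \<le> (s i)\<^sup>2" by (intro power_mono L L0)
      ultimately have "L\<^sup>2 \<le> (norm (X (e i) - X (e j)))\<^sup>2" by (simp add: add_increasing2)
      hence "L \<le> norm (X (e i) - X (e j))" by (rule power2_le_imp_le) simp
      moreover have "norm (X (e i) - X (e j)) < L"
        using N[of N "Suc N"] by (simp add: dist_norm i_def j_def)
      ultimately show False by simp
    qed
    thus ?thesis using L(1) by simp
  qed
  \<comment> \<open>Such a v equals all its residuals, so the bounds \<open>s n * norm v\<close> all
    apply, and they tend to 0.\<close>
  have "X v = 0" if v: "\<forall>n. cinner (e n) v = 0" for v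
  proof -
    have "norm (X v) \<le> s n * norm v" for n using main[of n] v by (auto simp: residual_def dest: spec[of _ v])
    moreover have "(\<lambda>n. s n * norm v) \<longlonglongrightarrow> 0 * norm v" by (intro tendsto_intros lim)
    ultimately have "norm (X v) \<le> 0 * norm v" by (intro LIMSEQ_le_const) auto
    thus ?thesis by simp
  qed
  hence "svd X s e" using bX dec lim ortho main by (simp add: svd_def)
  thus ?thesis by (rule that)
qed

section \<open>Left singular vectors and the series form of X\<close>

lemma svd_nonneg: "svd X s e \<Longrightarrow> 0 \<le> s n"
  unfolding svd_def using decseq_ge by blast

lemma svd_le: "svd X s e \<Longrightarrow> s n \<le> s 0"
  unfolding svd_def by (simp add: decseqD)

lemma svd_norm_vec: "svd X s e \<Longrightarrow> norm (e n) = (if s n = 0 then 0 else 1)"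
  unfolding svd_def ortho_system_def by (metis norm_zero)

lemma svd_norm:
  assumes X: "svd X s e"
  shows "norm (X (e n)) = s n"
  using cadjoint_gram_norm[of X "e n" "s n"] X svd_nonneg[OF X] svd_norm_vec[OF X]
  by (simp add: svd_def split: if_splits)

text \<open>This is 0 for \<open>s n = 0\<close>, since \<open>1 / 0 = 0\<close>.\<close>

definition left_vec :: "('a::chilbert_space \<Rightarrow> 'a) \<Rightarrow> (nat \<Rightarrow> real) \<Rightarrow> (nat \<Rightarrow> 'a) \<Rightarrow> nat \<Rightarrow> 'a" where
  "left_vec X s e n = complex_of_real (1 / s n) *\<^sub>C X (e n)"

lemma norm_left_vec: "svd X s e \<Longrightarrow> norm (left_vec X s e n) = (if s n = 0 then 0 else 1)"
  unfolding left_vec_def norm_scaleC using svd_norm[of X s e n] svd_nonneg[of X s e n]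
  by (simp add: norm_divide)

lemma svd_apply:
  assumes X: "svd X s e"
  shows "X (e n) = complex_of_real (s n) *\<^sub>C left_vec X s e n"
  using svd_norm[OF X, of n] by (cases "s n = 0") (simp_all add: left_vec_def scaleC_scaleC scaleC_one)

lemma ortho_left_vec:
  assumes X: "svd X s e"
  shows "ortho_system (left_vec X s e)"
proof -
  have bX: "bounded_clinear X" using X by (simp add: svd_def)
  have "cinner (X (e m)) (X (e n)) = 0" if "m \<noteq> n" for m n
  proof -
    have "cinner (X (e m)) (X (e n)) = cinner (e m) (cadjoint X (X (e n)))"
      by (simp add: cadjoint_right[OF bX])
    thus ?thesis using X that by (simp add: svd_def cinner_simps ortho_system_def)
  qed
  thus ?thesis
    unfolding ortho_system_def using norm_left_vec[OF X] by (auto simp: left_vec_def cinner_simps split: if_splits)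
qed

lemma svd_ortho: "svd X s e \<Longrightarrow> ortho_system e"
  by (simp add: svd_def)

lemma svd_sums:
  assumes X: "svd X s e"
  shows "(\<lambda>n. (complex_of_real (s n) * cinner (e n) v) *\<^sub>C left_vec X s e n) sums X v"
proof -
  have bX: "bounded_clinear X" using X by (simp add: svd_def)
  obtain x r where v: "v = x + r" "(\<lambda>n. cinner (e n) v *\<^sub>C e n) sums x" "\<And>n. cinner (e n) r = 0"
    by (rule ortho_decomposition[OF svd_ortho[OF X], of v]) blast
  have "X v = X x" using X v(3) by (simp add: v(1) bounded_clinear_add[OF bX] svd_def)
  thus ?thesis
    using bounded_clinear_sums[OF bX v(2)]
    by (simp add: bounded_clinear_scaleC[OF bX] svd_apply[OF X] scaleC_scaleC mult_ac)
qed

section \<open>Hoelder's inequality and its equality case\<close>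

lemma youngs_powr:
  fixes a t p :: real
  assumes p: "1 < p" and a: "0 \<le> a" and t: "0 \<le> t"
  shows "p * a powr (p - 1) * t \<le> (p - 1) * a powr p + t powr p"
proof (cases "a = 0 \<or> t = 0")
  case True
  thus ?thesis using p by auto
next
  case False
  have "(a powr p) powr ((p - 1) / p) * (t powr p) powr (1 / p)
      \<le> (p - 1) / p * a powr p + 1 / p * t powr p"
    using p False by (intro Youngs_inequality_0) (auto simp: field_simps)
  hence "a powr (p - 1) * t \<le> ((p - 1) * a powr p + t powr p) / p"
    using p False t by (simp add: powr_powr add_divide_distrib)
  thus ?thesis using p by (simp add: field_simps)
qed

text \<open>Equality makes t a zero, hence a minimum, of the nonnegative function \<phi>, so the
  derivative vanishes there; taking (p-1)-th powers is injective for p > 1. The neighbourhood of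
  radius t keeps the argument positive, where Young's inequality is available.\<close>

lemma youngs_powr_eqD:
  fixes a t p :: real
  assumes p: "1 < p" and a: "0 < a" and t: "0 \<le> t"
    and eq: "p * a powr (p - 1) * t = (p - 1) * a powr p + t powr p"
  shows "t = a"
proof -
  have "t \<noteq> 0" using eq p a by auto
  hence t0: "0 < t" using t by simp
  define \<phi> where "\<phi> = (\<lambda>x. (p - 1) * a powr p + x powr p - p * a powr (p - 1) * x)"
  have "DERIV \<phi> t :> p * t powr (p - 1) - p * a powr (p - 1)"
    unfolding \<phi>_def using t0 by (auto intro!: derivative_eq_intros)
  moreover have "\<forall>x. \<bar>t - x\<bar> < t \<longrightarrow> \<phi> t \<le> \<phi> x"
    using youngs_powr[OF p less_imp_le[OF a]] eq by (auto simp: \<phi>_def)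
  ultimately have "p * t powr (p - 1) - p * a powr (p - 1) = 0"
    by (rule DERIV_local_min[OF _ t0])
  hence "t powr (p - 1) = a powr (p - 1)" using p by simp
  thus ?thesis
    using p a t0 powr_less_mono2[of "p - 1" t a] powr_less_mono2[of "p - 1" a t] by linarith
qed

text \<open>With \<open>w m = t m powr p\<close> and the right singular vectors of Y this is the
  quadratic form <x, |Y|^p x>; with the left ones it is that of |Y*|^p.\<close>

definition weight_form :: "(nat \<Rightarrow> real) \<Rightarrow> (nat \<Rightarrow> 'a::chilbert_space) \<Rightarrow> 'a \<Rightarrow> real" where
  "weight_form w g x = (\<Sum>m. w m * (cmod (cinner (g m) x))\<^sup>2)"

lemma weight_form_summable:
  assumes w: "summable w" "\<And>m. 0 \<le> w m" and g: "ortho_system g"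
  shows "summable (\<lambda>m. w m * (cmod (cinner (g m) x))\<^sup>2)"
proof (rule summable_comparison_test'[of "\<lambda>m. w m * (norm x)\<^sup>2" 0])
  show "summable (\<lambda>m. w m * (norm x)\<^sup>2)" using w(1) by (rule summable_mult2)
  fix m
  have "cmod (cinner (g m) x) \<le> norm (g m) * norm x" by (rule cauchy_schwarz)
  also have "\<dots> \<le> 1 * norm x" by (intro mult_right_mono ortho_system_norm_le[OF g]) simp
  finally have "(cmod (cinner (g m) x))\<^sup>2 \<le> (norm x)\<^sup>2" by (simp add: power_mono)
  thus "norm (w m * (cmod (cinner (g m) x))\<^sup>2) \<le> w m * (norm x)\<^sup>2"
    using w(2) by (simp add: abs_mult mult_left_mono)
qed

lemma weight_form_nonneg:
  assumes w: "summable w" "\<And>m. 0 \<le> w m" and g: "ortho_system g"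
  shows "0 \<le> weight_form w g x"
  unfolding weight_form_def by (intro suminf_nonneg weight_form_summable[OF assms]) (simp add: w)

text \<open>A partial trace of |Y|^p in disguise: after exchanging the sums, Bessel's inequality for
  e at the vector \<open>g m\<close> bounds the factor of each \<open>w m\<close> by 1.\<close>

lemma sum_weight_form_le:
  assumes w: "summable w" "\<And>m. 0 \<le> w m" and g: "ortho_system g" and e: "bessel e"
  shows "(\<Sum>n<N. weight_form w g (e n)) \<le> (\<Sum>m. w m)"
proof -
  have "(\<Sum>n<N. weight_form w g (e n)) = (\<Sum>m. \<Sum>n<N. w m * (cmod (cinner (g m) (e n)))\<^sup>2)"
    unfolding weight_form_def by (intro suminf_sum[symmetric] weight_form_summable[OF w g])
  also have "\<dots> \<le> (\<Sum>m. w m)"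
  proof (intro suminf_le summable_sum weight_form_summable[OF w g] w(1))
    fix m
    have "(\<Sum>n<N. (cmod (cinner (g m) (e n)))\<^sup>2) \<le> (norm (g m))\<^sup>2"
      using e unfolding bessel_def cmod_cinner_commute[of "g m"] by blast
    also have "\<dots> \<le> 1" using ortho_system_norm_le[OF g] by (simp add: power_le_one)
    finally show "(\<Sum>n<N. w m * (cmod (cinner (g m) (e n)))\<^sup>2) \<le> w m"
      unfolding sum_distrib_left[symmetric] by (intro mult_left_le w(2))
  qed
  finally show ?thesis .
qed

text \<open>The product \<open>|\<langle>g\<^sub>m, x\<rangle>| |\<langle>y, h\<^sub>m\<rangle>|\<close> is bounded by AM-GM, and then
  \<open>p a\<^bsup>p-1\<^esup> t\<^sub>m\<close> by Young's inequality; equality in the sum forces equality for every \<open>m\<close>.\<close>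

lemma
  fixes Y :: "'a::chilbert_space \<Rightarrow> 'a"
  assumes Y: "svd Y t g" and p: "1 < p" and sm: "summable (\<lambda>m. t m powr p)"
    and x: "norm x \<le> 1" and y: "norm y \<le> 1" and a: "0 \<le> a"
  defines "E \<equiv> weight_form (\<lambda>m. t m powr p) g x"
    and "F \<equiv> weight_form (\<lambda>m. t m powr p) (left_vec Y t g) y"
  shows svd_young: "p * a powr (p - 1) * cmod (cinner y (Y x)) \<le> (p - 1) * a powr p + (E + F) / 2"
    and svd_young_eqD: "\<lbrakk>0 < a; p * a powr (p - 1) * Re (cinner y (Y x)) = (p - 1) * a powr p + (E + F) / 2\<rbrakk>
      \<Longrightarrow> Y x = complex_of_real a *\<^sub>C y \<and> E = a powr p"
proof -
  define h where "h = left_vec Y t g"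
  define \<xi> where "\<xi> = (\<lambda>m. cmod (cinner (g m) x))"
  define \<eta> where "\<eta> = (\<lambda>m. cmod (cinner (h m) y))"
  have g: "ortho_system g" and h: "ortho_system h"
    using svd_ortho[OF Y] ortho_left_vec[OF Y] by (simp_all add: h_def)
  have t0: "0 \<le> t m" for m by (rule svd_nonneg[OF Y])
  have sx: "summable (\<lambda>m. (\<xi> m)\<^sup>2)" and sy: "summable (\<lambda>m. (\<eta> m)\<^sup>2)"
    unfolding \<xi>_def \<eta>_def by (intro bessel_summable ortho_system_bessel g h)+
  have x1: "(\<Sum>m. (\<xi> m)\<^sup>2) \<le> 1" and y1: "(\<Sum>m. (\<eta> m)\<^sup>2) \<le> 1"
    using bessel_suminf_le[OF ortho_system_bessel[OF g], of x] bessel_suminf_le[OF ortho_system_bessel[OF h], of y]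
      power_le_one[OF norm_ge_zero x, of 2] power_le_one[OF norm_ge_zero y, of 2]
    unfolding \<xi>_def \<eta>_def by linarith+
  have sE: "(\<lambda>m. t m powr p * (\<xi> m)\<^sup>2) sums E" and sF: "(\<lambda>m. t m powr p * (\<eta> m)\<^sup>2) sums F"
    unfolding \<xi>_def \<eta>_def E_def F_def h_def weight_form_def
    by (intro summable_sums weight_form_summable sm g h[unfolded h_def] powr_ge_zero)+
  define u where "u = (\<lambda>m. t m * (\<xi> m * \<eta> m))"
  have xy: "\<xi> m * \<eta> m \<le> ((\<xi> m)\<^sup>2 + (\<eta> m)\<^sup>2) / 2" for m
    using sum_squares_bound[of "\<xi> m" "\<eta> m"] by simp
  have xy0: "0 \<le> \<xi> m" "0 \<le> \<eta> m" for m by (simp_all add: \<xi>_def \<eta>_def)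
  have u0: "0 \<le> u m" for m using t0 xy0 by (simp add: u_def)
  have su: "summable u"
  proof (rule summable_comparison_test'[of "\<lambda>m. t 0 * (((\<xi> m)\<^sup>2 + (\<eta> m)\<^sup>2) / 2)" 0])
    show "summable (\<lambda>m. t 0 * (((\<xi> m)\<^sup>2 + (\<eta> m)\<^sup>2) / 2))"
      by (intro summable_mult summable_divide summable_add sx sy)
    fix m
    have "u m \<le> t 0 * (((\<xi> m)\<^sup>2 + (\<eta> m)\<^sup>2) / 2)"
      unfolding u_def by (intro mult_mono svd_le[OF Y] xy t0) (use xy0 in simp)
    thus "norm (u m) \<le> t 0 * (((\<xi> m)\<^sup>2 + (\<eta> m)\<^sup>2) / 2)" using u0 by simp
  qed
  have Yx: "(\<lambda>m. (complex_of_real (t m) * cinner (g m) x) *\<^sub>C h m) sums Y x"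
    unfolding h_def by (rule svd_sums[OF Y])
  have "(\<lambda>m. cinner y ((complex_of_real (t m) * cinner (g m) x) *\<^sub>C h m)) sums cinner y (Y x)"
    by (rule bounded_linear.sums[OF cinner.bounded_linear_right Yx])
  moreover have nu: "cmod (cinner y ((complex_of_real (t m) * cinner (g m) x) *\<^sub>C h m)) = u m" for m
    using t0 by (simp add: cinner_simps norm_mult u_def \<xi>_def \<eta>_def cmod_cinner_commute[of y])
  ultimately have ub: "cmod (cinner y (Y x)) \<le> (\<Sum>m. u m)"
    using summable_norm[of "\<lambda>m. cinner y ((complex_of_real (t m) * cinner (g m) x) *\<^sub>C h m)"] su
    by (simp add: sums_iff)
  \<comment> \<open>The Young bound times the AM-GM bound, term by term. In the sum, the factor of
    (p - 1) a^p becomes D, the mean of two Bessel sums, which is at most 1.\<close>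
  define b where "b = (\<lambda>m. ((p - 1) * a powr p + t m powr p) * (((\<xi> m)\<^sup>2 + (\<eta> m)\<^sup>2) / 2))"
  define D where "D = ((\<Sum>m. (\<xi> m)\<^sup>2) + (\<Sum>m. (\<eta> m)\<^sup>2)) / 2"
  have D1: "D \<le> 1" using x1 y1 by (simp add: D_def)
  have c0: "0 \<le> (p - 1) * a powr p" using p by simp
  have "(\<lambda>m. (p - 1) * a powr p * (((\<xi> m)\<^sup>2 + (\<eta> m)\<^sup>2) / 2) + (t m powr p * (\<xi> m)\<^sup>2 + t m powr p * (\<eta> m)\<^sup>2) / 2)
     sums ((p - 1) * a powr p * D + (E + F) / 2)"
    unfolding D_def
    by (intro sums_add sums_mult sums_divide sE sF summable_sums sx sy)
  moreover have "b m = (p - 1) * a powr p * (((\<xi> m)\<^sup>2 + (\<eta> m)\<^sup>2) / 2)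
      + (t m powr p * (\<xi> m)\<^sup>2 + t m powr p * (\<eta> m)\<^sup>2) / 2" for m
    by (simp add: b_def field_simps)
  ultimately have bs: "b sums ((p - 1) * a powr p * D + (E + F) / 2)" by presburger
  have ub': "p * a powr (p - 1) * u m \<le> b m" for m
  proof -
    have "p * a powr (p - 1) * u m = (p * a powr (p - 1) * t m) * (\<xi> m * \<eta> m)" by (simp add: u_def)
    also have "\<dots> \<le> b m"
      unfolding b_def using xy0 youngs_powr[OF p a t0] c0 by (intro mult_mono xy) auto
    finally show ?thesis .
  qed
  have *: "p * a powr (p - 1) * (\<Sum>m. u m) \<le> (p - 1) * a powr p * D + (E + F) / 2"
    unfolding sums_unique[OF bs] suminf_mult[OF su, symmetric]
    by (intro suminf_le ub' summable_mult su sums_summable[OF bs])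
  have **: "(p - 1) * a powr p * D \<le> (p - 1) * a powr p" using c0 D1 by (rule mult_left_le[rotated])
  have ***: "p * a powr (p - 1) * cmod (cinner y (Y x)) \<le> p * a powr (p - 1) * (\<Sum>m. u m)"
    using p ub by (intro mult_left_mono) auto
  show "p * a powr (p - 1) * cmod (cinner y (Y x)) \<le> (p - 1) * a powr p + (E + F) / 2"
    using * ** *** by linarith
  assume a0: "0 < a" and eq: "p * a powr (p - 1) * Re (cinner y (Y x)) = (p - 1) * a powr p + (E + F) / 2"
  have "p * a powr (p - 1) * Re (cinner y (Y x)) \<le> p * a powr (p - 1) * cmod (cinner y (Y x))"
    using p by (intro mult_left_mono complex_Re_le_cmod) auto
  \<comment> \<open>Every inequality in the chain must be an equality: the Bessel sums are 1, and no
    term of u has slack against b.\<close>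
  hence eq1: "(p - 1) * a powr p * D = (p - 1) * a powr p"
    and eq2: "p * a powr (p - 1) * (\<Sum>m. u m) = (p - 1) * a powr p * D + (E + F) / 2"
    using * ** *** eq by linarith+
  have "D = 1" using eq1 p a0 by simp
  hence x1': "(\<Sum>m. (\<xi> m)\<^sup>2) = 1" and y1': "(\<Sum>m. (\<eta> m)\<^sup>2) = 1" using x1 y1 by (simp_all add: D_def)
  have "(\<lambda>m. b m - p * a powr (p - 1) * u m) sums 0"
    using sums_diff[OF bs summable_sums[OF summable_mult[OF su, of "p * a powr (p - 1)"]]]
    by (simp add: suminf_mult[OF su] eq2)
  hence slack: "b m = p * a powr (p - 1) * u m" for m
    using suminf_eq_zero_iff[of "\<lambda>m. b m - p * a powr (p - 1) * u m"] ub' by (simp add: sums_iff)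
  \<comment> \<open>At an index with nonzero weight the weight cancels and equality in Young's
    inequality remains, which pins \<open>t m\<close> to a. Elsewhere \<open>\<xi> m\<close> and
    \<open>\<eta> m\<close> vanish, so \<open>t m\<close> may be replaced by a in all the
    sums.\<close>
  have tm: "t m = a" if nz: "\<xi> m \<noteq> 0 \<or> \<eta> m \<noteq> 0" for m
  proof -
    have pos: "0 < ((\<xi> m)\<^sup>2 + (\<eta> m)\<^sup>2) / 2" using nz by (simp add: sum_power2_gt_zero_iff)
    have "b m = (p * a powr (p - 1) * t m) * (\<xi> m * \<eta> m)" using slack by (simp add: u_def)
    also have "\<dots> \<le> (p * a powr (p - 1) * t m) * (((\<xi> m)\<^sup>2 + (\<eta> m)\<^sup>2) / 2)"
      using p t0 by (intro mult_left_mono xy) auto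
    finally have "(p - 1) * a powr p + t m powr p \<le> p * a powr (p - 1) * t m"
      unfolding b_def using pos by (simp only: mult_le_cancel_right_pos)
    thus ?thesis using youngs_powr[OF p a t0, of m] youngs_powr_eqD[OF p a0 t0, of m] by simp
  qed
  have tp: "t m powr p * (\<xi> m)\<^sup>2 = a powr p * (\<xi> m)\<^sup>2" "t m powr p * (\<eta> m)\<^sup>2 = a powr p * (\<eta> m)\<^sup>2"
    and t2: "(t m)\<^sup>2 * (\<xi> m)\<^sup>2 = a\<^sup>2 * (\<xi> m)\<^sup>2" for m
    using tm[of m] by auto
  hence E: "E = a powr p" and F: "F = a powr p"
    using sums_unique[OF sE] sums_unique[OF sF]
    unfolding tp suminf_mult[OF sx] suminf_mult[OF sy] x1' y1' by simp_all
  have "p * a powr (p - 1) * Re (cinner y (Y x)) = p * a powr p" using eq E F by (simp add: algebra_simps)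
  also have "a powr p = a powr (p - 1) * a" using a0 by (simp add: powr_diff)
  finally have re: "Re (cinner y (Y x)) = a" using p a0 by simp
  have "(norm (Y x))\<^sup>2 = (\<Sum>m. (cmod (complex_of_real (t m) * cinner (g m) x))\<^sup>2 * (norm (h m))\<^sup>2)"
    by (rule sums_unique[OF norm_ortho_sums[OF h Yx]])
  also have "\<dots> \<le> (\<Sum>m. a\<^sup>2 * (\<xi> m)\<^sup>2)"
  proof (intro suminf_le sums_summable[OF norm_ortho_sums[OF h Yx]] summable_mult sx)
    fix m
    have "(cmod (complex_of_real (t m) * cinner (g m) x))\<^sup>2 * (norm (h m))\<^sup>2 \<le> (t m)\<^sup>2 * (\<xi> m)\<^sup>2"
      using ortho_system_norm_le[OF h, of m] 
      by (simp add: norm_mult power_mult_distrib \<xi>_def mult_left_le power_le_one)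
    thus "(cmod (complex_of_real (t m) * cinner (g m) x))\<^sup>2 * (norm (h m))\<^sup>2 \<le> a\<^sup>2 * (\<xi> m)\<^sup>2"
      by (simp only: t2)
  qed
  also have "\<dots> = a\<^sup>2" by (simp add: suminf_mult[OF sx] x1')
  finally have nY: "(norm (Y x))\<^sup>2 \<le> a\<^sup>2" .
  \<comment> \<open>Now |Y x| \<le> a, |y| \<le> 1 and Re <y, Y x> = a: the equality case of
    Cauchy-Schwarz, visible in the expanded square of |Y x - a y|.\<close>
  have "a\<^sup>2 * (norm y)\<^sup>2 \<le> a\<^sup>2" using y by (simp add: mult_left_le power_le_one)
  moreover have "(norm (Y x - complex_of_real a *\<^sub>C y))\<^sup>2 = (norm (Y x))\<^sup>2 + a\<^sup>2 * (norm y)\<^sup>2 - 2 * a\<^sup>2"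
    using re cinner_commute[of "Y x" y]
    by (simp add: norm_diff_square norm_scaleC power_mult_distrib cinner_simps) (simp add: power2_eq_square)
  ultimately have "(norm (Y x - complex_of_real a *\<^sub>C y))\<^sup>2 \<le> 0" using nY by linarith
  thus "Y x = complex_of_real a *\<^sub>C y \<and> E = a powr p" using E by simp
qed

text \<open>Finite sums and upper bounds T and A instead of exact norms make it applicable where
  summability of \<open>a n powr p\<close> is still to be shown, and to tails of a series.\<close>

lemma schatten_hoelder:
  fixes Y :: "'a::chilbert_space \<Rightarrow> 'a"
  assumes Y: "svd Y t g" and p: "1 < p" and sm: "summable (\<lambda>m. t m powr p)"
    and T: "(\<Sum>m. t m powr p) \<le> T powr p" "0 < T"
    and e: "bessel e" and f: "bessel f"
    and a: "\<And>n. 0 \<le> a n" and A: "(\<Sum>n<N. a n powr p) \<le> A powr p" "0 < A"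
  shows "(\<Sum>n<N. a n powr (p - 1) * cmod (cinner (f n) (Y (e n)))) \<le> A powr (p - 1) * T"
proof -
  \<comment> \<open>Rescaling by T / A turns A^p into T^p, so that the two sides of Young's
    inequality carry equal totals and add up to p T^p.\<close>
  define c where "c = T / A"
  have c: "0 < c" using T A by (simp add: c_def)
  have bound: "(\<Sum>n<N. weight_form (\<lambda>m. t m powr p) k (u n)) \<le> T powr p"
    if "ortho_system k" "bessel u" for k and u :: "nat \<Rightarrow> 'a"
    using sum_weight_form_le[OF sm powr_ge_zero that, of N] T(1) by linarith
  have "p * c powr (p - 1) * (\<Sum>n<N. a n powr (p - 1) * cmod (cinner (f n) (Y (e n))))
      = (\<Sum>n<N. p * (c * a n) powr (p - 1) * cmod (cinner (f n) (Y (e n))))"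
    using c a by (simp add: sum_distrib_left powr_mult mult_ac)
  also have "\<dots> \<le> (\<Sum>n<N. (p - 1) * (c * a n) powr p + (weight_form (\<lambda>m. t m powr p) g (e n)
      + weight_form (\<lambda>m. t m powr p) (left_vec Y t g) (f n)) / 2)"
    using c a by (intro sum_mono svd_young[OF Y p sm] bessel_norm_le e f) auto
  also have "\<dots> = (p - 1) * c powr p * (\<Sum>n<N. a n powr p) + ((\<Sum>n<N. weight_form (\<lambda>m. t m powr p) g (e n))
      + (\<Sum>n<N. weight_form (\<lambda>m. t m powr p) (left_vec Y t g) (f n))) / 2"
    using c a by (simp add: sum.distrib powr_mult sum_distrib_left sum_divide_distrib[symmetric] mult_ac)
  also have "\<dots> \<le> (p - 1) * c powr p * A powr p + (T powr p + T powr p) / 2"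
    using p by (intro add_mono mult_left_mono A(1) divide_right_mono bound svd_ortho[OF Y] ortho_left_vec[OF Y] e f) auto
  also have "c powr p * A powr p = T powr p" using c A T by (simp add: c_def powr_divide)
  hence "(p - 1) * c powr p * A powr p + (T powr p + T powr p) / 2 = p * T powr p" by (simp add: algebra_simps)
  also have "T powr p = c powr (p - 1) * (A powr (p - 1) * T)"
    using A T by (simp add: c_def powr_divide powr_diff)
  finally show ?thesis using p c by (simp add: mult.assoc)
qed

text \<open>With both power sums equal to S, the estimates for the single indices lose nothing in
  total, hence nothing at any index. The phase of the pairing is meant to be absorbed in f, which is
  why real parts appear.\<close>

lemma schatten_hoelder_eqD:
  fixes Y :: "'a::chilbert_space \<Rightarrow> 'a"
  assumes Y: "svd Y t g" and p: "1 < p" and t: "(\<lambda>m. t m powr p) sums S"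
    and e: "ortho_system e" and f: "bessel f"
    and a: "\<And>n. 0 \<le> a n" and ea: "\<And>n. a n = 0 \<Longrightarrow> e n = 0" and aS: "(\<lambda>n. a n powr p) sums S"
    and eq: "(\<lambda>n. a n powr (p - 1) * Re (cinner (f n) (Y (e n)))) sums S"
  shows "Y (e n) = complex_of_real (a n) *\<^sub>C f n"
    and "(\<And>n. cinner (e n) v = 0) \<Longrightarrow> Y v = 0"
proof -
  have sm: "summable (\<lambda>m. t m powr p)" and S: "(\<Sum>m. t m powr p) = S" using t by (simp_all add: sums_iff)
  have bY: "bounded_clinear Y" using Y by (simp add: svd_def)
  define E where "E = (\<lambda>x. weight_form (\<lambda>m. t m powr p) g x)"
  define F where "F = (\<lambda>x. weight_form (\<lambda>m. t m powr p) (left_vec Y t g) x)"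
  have g: "ortho_system g" "ortho_system (left_vec Y t g)" by (rule svd_ortho[OF Y] ortho_left_vec[OF Y])+
  have E0: "0 \<le> E x" "0 \<le> F x" for x
    unfolding E_def F_def by (intro weight_form_nonneg sm g powr_ge_zero)+
  have leE: "(\<Sum>n<N. E (u n)) \<le> S" "(\<Sum>n<N. F (u n)) \<le> S" if "bessel u" for u N
    unfolding E_def F_def S[symmetric] by (intro sum_weight_form_le sm g powr_ge_zero that)+
  have be: "bessel e" by (rule ortho_system_bessel[OF e])
  have sE: "summable (\<lambda>n. E (e n))" and sF: "summable (\<lambda>n. F (f n))"
    by (intro summableI_nonneg_bounded[of _ S] E0 leE be f)+
  have lE: "(\<Sum>n. E (e n)) \<le> S" and lF: "(\<Sum>n. F (f n)) \<le> S"
    by (intro suminf_le_const sE sF leE be f)+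
  \<comment> \<open>Slack of Young's estimate at index n. The two weight sums are at most S, so the
    slacks add up to at most (p - 1) S + S - p S = 0.\<close>
  define gap where "gap = (\<lambda>n. (p - 1) * a n powr p + (E (e n) + F (f n)) / 2
    - p * (a n powr (p - 1) * Re (cinner (f n) (Y (e n)))))"
  have gap0: "0 \<le> gap n" for n
  proof -
    have "p * a n powr (p - 1) * Re (cinner (f n) (Y (e n))) \<le> p * a n powr (p - 1) * cmod (cinner (f n) (Y (e n)))"
      using p by (intro mult_left_mono complex_Re_le_cmod) auto
    also have "\<dots> \<le> (p - 1) * a n powr p + (E (e n) + F (f n)) / 2"
      unfolding E_def F_def by (intro svd_young[OF Y p sm] bessel_norm_le be f a)
    finally show ?thesis by (simp add: gap_def mult.assoc)
  qed
  have gs: "gap sums ((p - 1) * S + ((\<Sum>n. E (e n)) + (\<Sum>n. F (f n))) / 2 - p * S)"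
    unfolding gap_def by (intro sums_add sums_diff sums_mult sums_divide aS eq summable_sums sE sF)
  moreover have "(p - 1) * S + ((\<Sum>n. E (e n)) + (\<Sum>n. F (f n))) / 2 - p * S \<le> 0"
    using lE lF by (simp add: algebra_simps)
  ultimately have "(\<Sum>n. gap n) = 0"
    using suminf_nonneg[OF sums_summable[OF gs] gap0] by (simp add: sums_iff)
  hence gapz: "gap n = 0" for n using suminf_eq_zero_iff[OF sums_summable[OF gs] gap0] by simp
  have main: "Y (e n) = complex_of_real (a n) *\<^sub>C f n \<and> E (e n) = a n powr p" for n
  proof (cases "a n = 0")
    \<comment> \<open>The equality case of Young's inequality is stated for positive a only, but
      here \<open>e n\<close> is the zero vector.\<close>
    case True
    thus ?thesis using ea[of n] bounded_clinear_zero[OF bY] by (simp add: E_def weight_form_def cinner.zero_right)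
  next
    case False
    hence "0 < a n" using a[of n] by simp
    thus ?thesis
      using svd_young_eqD[OF Y p sm bessel_norm_le[OF be, of n] bessel_norm_le[OF f, of n] a[of n]] gapz[of n]
      by (simp add: gap_def E_def F_def mult.assoc)
  qed
  thus "Y (e n) = complex_of_real (a n) *\<^sub>C f n" by blast
  assume v: "\<And>n. cinner (e n) v = 0"
  show "Y v = 0"
  proof (cases "v = 0")
    case False
    define u where "u = complex_of_real (1 / norm v) *\<^sub>C v"
    have nu: "norm u = 1" using False by (simp add: u_def norm_scaleC norm_divide)
    have eu: "cinner (e n) u = 0" "cinner u (e n) = 0" for n
      using v[of n] cinner_zero_commute[of "e n" v] by (simp_all add: u_def cinner_simps)
    have "ortho_system (case_nat u e)"
      using e eu nu unfolding ortho_system_def by (simp split: nat.split) 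
    \<comment> \<open>The vectors \<open>e n\<close> already exhaust \<open>S\<close>, so nothing is left for the additional vector \<open>u\<close>.\<close>
    hence "(\<Sum>n<Suc N. E (case_nat u e n)) \<le> S" for N by (intro leE ortho_system_bessel)
    hence "(\<Sum>n<N. a n powr p) \<le> S - E u" for N
      using main by (simp add: sum.lessThan_Suc_shift del: sum.lessThan_Suc) (smt (verit))
    hence "S \<le> S - E u" using aS unfolding sums_def by (intro LIMSEQ_le_const2) auto
    hence "E u = 0" using E0(1)[of u] by simp
    hence z: "t m powr p * (cmod (cinner (g m) u))\<^sup>2 = 0" for m
      unfolding E_def weight_form_def
      using suminf_eq_zero_iff[OF weight_form_summable[OF sm powr_ge_zero g(1), of u]] by simp
    have "(complex_of_real (t m) * cinner (g m) u) *\<^sub>C left_vec Y t g m = 0" for m using z[of m] by auto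
    hence "(\<lambda>m. 0) sums Y u" using svd_sums[OF Y, of u] by presburger
    hence "Y u = 0" by (rule sums_unique2[OF _ sums_zero])
    thus ?thesis using False by (simp add: u_def bounded_clinear_scaleC[OF bY])
  qed (simp add: bounded_clinear_zero[OF bY])
qed

section \<open>The operators attached to a singular value decomposition\<close>

lemma bounded_clinear_compose: "bounded_clinear S \<Longrightarrow> bounded_clinear T \<Longrightarrow> bounded_clinear (S \<circ> T)"
  unfolding bounded_clinear_def by (auto simp: o_def intro: bounded_linear_compose)

lemma series_op_vec:
  assumes e: "ortho_system e"
  shows "series_op c e f (e k) = (c k * (norm (e k))\<^sup>2) *\<^sub>C f k"
proof -
  have "(\<lambda>n. (c n * cinner (e n) (e k)) *\<^sub>C f n) = (\<lambda>n. if n = k then (c n * (norm (e n))\<^sup>2) *\<^sub>C f n else 0)"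
    using e by (auto simp: ortho_system_def cinner_self)
  thus ?thesis
    unfolding series_op_def
    using sums_unique[OF sums_single[of k "\<lambda>n. (c n * complex_of_real ((norm (e n))\<^sup>2)) *\<^sub>C f n"]] by simp
qed

lemma series_op_orthogonal: "(\<And>n. cinner (e n) v = 0) \<Longrightarrow> series_op c e f v = 0"
  by (simp add: series_op_def)

definition diag_op :: "(nat \<Rightarrow> real) \<Rightarrow> (nat \<Rightarrow> 'a::chilbert_space) \<Rightarrow> 'a \<Rightarrow> 'a" where
  "diag_op c e = series_op (\<lambda>n. complex_of_real (c n)) e e"

lemma
  assumes e: "ortho_system e" and c: "\<And>n. \<bar>c n\<bar> \<le> K"
  shows diag_op_sums: "(\<lambda>n. (complex_of_real (c n) * cinner (e n) v) *\<^sub>C e n) sums diag_op c e v"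
    and bounded_clinear_diag_op: "bounded_clinear (diag_op c e)"
    and cinner_diag_op: "cinner (e k) (diag_op c e v) = complex_of_real (c k) * cinner (e k) v"
proof -
  have c': "cmod (complex_of_real (c n)) \<le> K" for n using c by simp
  show s: "(\<lambda>n. (complex_of_real (c n) * cinner (e n) v) *\<^sub>C e n) sums diag_op c e v"
    unfolding diag_op_def by (rule series_op_sums[OF ortho_system_bessel[OF e] e c'])
  show "bounded_clinear (diag_op c e)"
    unfolding diag_op_def by (rule bounded_clinear_series_op[OF ortho_system_bessel[OF e] e c'])
  have "e k = 0 \<or> norm (e k) = 1" using e by (auto simp: ortho_system_def)
  thus "cinner (e k) (diag_op c e v) = complex_of_real (c k) * cinner (e k) v"
    using cinner_ortho_sums[OF e s, of k] by (auto simp: cinner.zero_left)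
qed

lemma diag_op_vec:
  assumes "ortho_system e"
  shows "diag_op c e (e k) = complex_of_real (c k) *\<^sub>C e k"
proof -
  have "e k = 0 \<or> norm (e k) = 1" using assms by (auto simp: ortho_system_def)
  thus ?thesis unfolding diag_op_def series_op_vec[OF assms] by auto
qed

lemma diag_op_orthogonal: "(\<And>n. cinner (e n) v = 0) \<Longrightarrow> diag_op c e v = 0"
  unfolding diag_op_def by (rule series_op_orthogonal)

lemma positive_diag_op:
  assumes e: "ortho_system e" and c: "\<And>n. 0 \<le> c n" "\<And>n. c n \<le> K"
  shows "positive_op (diag_op c e)"
  unfolding positive_op_def
proof (intro conjI allI)
  have c': "\<bar>c n\<bar> \<le> K" for n using c by simp
  show "bounded_clinear (diag_op c e)" by (rule bounded_clinear_diag_op[OF e c'])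
  fix v
  have "(\<lambda>n. cinner v ((complex_of_real (c n) * cinner (e n) v) *\<^sub>C e n)) sums cinner v (diag_op c e v)"
    by (rule bounded_linear.sums[OF cinner.bounded_linear_right diag_op_sums[OF e c']])
  moreover have "cinner v ((complex_of_real (c n) * cinner (e n) v) *\<^sub>C e n)
      = complex_of_real (c n * (cmod (cinner (e n) v))\<^sup>2)" for n
    unfolding cinner_scaleC_right of_real_mult complex_norm_square cinner_commute[of v "e n"] by simp
  ultimately have "(\<lambda>n. complex_of_real (c n * (cmod (cinner (e n) v))\<^sup>2)) sums cinner v (diag_op c e v)"
    by simp
  hence s: "(\<lambda>n. c n * (cmod (cinner (e n) v))\<^sup>2) sums Re (cinner v (diag_op c e v))"
    and i: "Im (cinner v (diag_op c e v)) = 0"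
    using sums_Re sums_Im sums_unique2[OF _ sums_zero] by force+
  have "0 \<le> Re (cinner v (diag_op c e v))"
    unfolding sums_unique[OF s] by (intro suminf_nonneg sums_summable[OF s]) (simp add: c)
  thus "cinner v (diag_op c e v) \<in> \<real>\<^sub>\<ge>\<^sub>0" using i by (simp add: complex_nonneg_Reals_iff)
qed

text \<open>Since Q annihilates w = Q v, adding multiples of w to v keeps the image w, while the
  inner product with w can be given any real part; positivity excludes that unless w = 0.\<close>

lemma positive_op_square_zero:
  assumes Q: "positive_op Q" and z: "Q (Q v) = 0"
  shows "Q v = 0"
proof (rule ccontr)
  have bQ: "bounded_clinear Q" using Q by (simp add: positive_op_def)
  define w where "w = Q v"
  assume "Q v \<noteq> 0"
  hence nw: "0 < (norm w)\<^sup>2" by (simp add: w_def)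
  \<comment> \<open>Chosen so that the real part computed below is -1.\<close>
  define c where "c = complex_of_real (- (Re (cinner v w) + 1) / (norm w)\<^sup>2)"
  have "Q (v + c *\<^sub>C w) = w"
    using z by (simp add: bounded_clinear_add[OF bQ] bounded_clinear_scaleC[OF bQ] w_def)
  hence "0 \<le> Re (cinner (v + c *\<^sub>C w) w)"
    using Q unfolding positive_op_def complex_nonneg_Reals_iff by metis
  also have "cinner (v + c *\<^sub>C w) w = cinner v w + complex_of_real (- (Re (cinner v w) + 1))"
    using nw by (simp add: cinner_simps cinner_self c_def)
  finally show False by simp
qed

text \<open>As (Q + t)(Q - t) v = 0, a nonzero w = (Q - t) v would be an eigenvector for -t <
  0.\<close>

lemma positive_op_square_eigen:
  assumes Q: "positive_op Q" and t: "0 < t" and z: "Q (Q v) = complex_of_real (t\<^sup>2) *\<^sub>C v"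
  shows "Q v = complex_of_real t *\<^sub>C v"
proof -
  have bQ: "bounded_clinear Q" using Q by (simp add: positive_op_def)
  define w where "w = Q v - complex_of_real t *\<^sub>C v"
  have "Q w = complex_of_real (- t) *\<^sub>C w"
    using z by (simp add: w_def bounded_clinear_diff[OF bQ] bounded_clinear_scaleC[OF bQ]
        complex_vector.scale_right_diff_distrib power2_eq_square)
  moreover have "0 \<le> Re (cinner w (Q w))"
    using Q unfolding positive_op_def complex_nonneg_Reals_iff by blast
  ultimately have "0 \<le> - (t * (norm w)\<^sup>2)" by (simp add: cinner_simps cinner_self del: complex_vector.scale_minus_left flip: of_real_power)
  hence "w = 0" using t by (simp add: mult_le_0_iff)
  thus ?thesis by (simp add: w_def)
qed

lemma svd_zero_iff: "svd X s e \<Longrightarrow> e n = 0 \<longleftrightarrow> s n = 0"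
  by (simp add: svd_def)

lemma svd_abs_bound: "svd X s e \<Longrightarrow> \<bar>s n\<bar> \<le> s 0"
  using svd_nonneg[of X s e n] svd_le[of X s e n] by simp

text \<open>Uniqueness of the positive square root is checked on vectors: each \<open>e n\<close> is
  zero or an eigenvector of X*X with positive eigenvalue, and X*X vanishes on the complement of the
  system. The two facts about squares of positive operators settle these cases.\<close>

lemma abs_op_svd:
  assumes X: "svd X s e"
  shows "abs_op X = diag_op s e"
  unfolding abs_op_def
proof (rule the_equality)
  have bX: "bounded_clinear X" using X by (simp add: svd_def)
  have e: "ortho_system e" by (rule svd_ortho[OF X])
  have bP: "bounded_clinear (diag_op s e)" by (rule bounded_clinear_diag_op[where c = s, OF e svd_abs_bound[OF X]])
  have gram: "cadjoint X (X (e n)) = complex_of_real ((s n)\<^sup>2) *\<^sub>C e n" for n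
    using X by (simp add: svd_def)
  have Xz: "X v = 0" if "\<And>n. cinner (e n) v = 0" for v using X that by (simp add: svd_def)
  have bG: "bounded_clinear (cadjoint X \<circ> X)" by (intro bounded_clinear_compose bounded_clinear_cadjoint bX)
  have "diag_op s e \<circ> diag_op s e = cadjoint X \<circ> X"
    by (rule bounded_clinear_eqI[OF e bounded_clinear_compose[OF bP bP] bG])
      (simp_all add: diag_op_vec[OF e] bounded_clinear_scaleC[OF bP] gram scaleC_scaleC power2_eq_square
        diag_op_orthogonal Xz bounded_clinear_zero[OF bP] bounded_clinear_zero[OF bounded_clinear_cadjoint[OF bX]])
  thus "positive_op (diag_op s e) \<and> diag_op s e \<circ> diag_op s e = cadjoint X \<circ> X"
    using positive_diag_op[where c = s, OF e svd_nonneg[OF X] svd_le[OF X]] by blast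
  fix Q assume Q: "positive_op Q \<and> Q \<circ> Q = cadjoint X \<circ> X"
  hence bQ: "bounded_clinear Q" by (simp add: positive_op_def)
  have QQ: "Q (Q v) = cadjoint X (X v)" for v using Q by (metis comp_apply)
  show "Q = diag_op s e"
  proof (rule bounded_clinear_eqI[OF e bQ bP])
    fix n
    show "Q (e n) = diag_op s e (e n)"
    proof (cases "s n = 0")
      case True
      hence "e n = 0" using X by (simp add: svd_def)
      thus ?thesis by (simp add: bounded_clinear_zero bQ bP)
    next
      case False
      hence "0 < s n" using svd_nonneg[OF X, of n] by simp
      thus ?thesis using positive_op_square_eigen[of Q "s n" "e n"] Q by (simp add: QQ gram diag_op_vec[OF e])
    qed
  next
    fix v assume v: "\<And>n. cinner (e n) v = 0"
    have "Q v = 0"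
    proof (rule positive_op_square_zero[of Q v])
      show "positive_op Q" using Q by blast
      show "Q (Q v) = 0" unfolding QQ Xz[OF v] by (rule bounded_clinear_zero[OF bounded_clinear_cadjoint[OF bX]])
    qed
    thus "Q v = diag_op s e v" by (simp add: diag_op_orthogonal[OF v])
  qed
qed

text \<open>Existence has to be verified for every eigenvector of |X|, not only for the
  \<open>e n\<close>: comparing coefficients shows that an eigenvector for t has components only
  along those \<open>e n\<close> with \<open>s n = t\<close>. Uniqueness follows from the
  requirement on the \<open>e n\<close> and on the kernel.\<close>

lemma op_powr_svd:
  assumes X: "svd X s e" and r: "0 < r"
  shows "op_powr (abs_op X) r = diag_op (\<lambda>n. s n powr r) e"
  unfolding op_powr_def abs_op_svd[OF X]
proof (rule the_equality)
  have e: "ortho_system e" by (rule svd_ortho[OF X])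
  have b: "\<bar>s n powr r\<bar> \<le> s 0 powr r" for n
    using r svd_le[OF X] svd_nonneg[OF X] by (simp add: powr_mono2)
  have bS: "bounded_clinear (diag_op (\<lambda>n. s n powr r) e)" by (rule bounded_clinear_diag_op[where c = "\<lambda>n. s n powr r", OF e b])
  have ev: "diag_op (\<lambda>n. s n powr r) e v = complex_of_real (t powr r) *\<^sub>C v"
    if v: "diag_op s e v = complex_of_real t *\<^sub>C v" for t v
  proof -
    have sn: "s n = t \<or> cinner (e n) v = 0" for n
      using cinner_diag_op[where c = s, OF e svd_abs_bound[OF X], of n v] by (auto simp: v cinner_simps)
    show ?thesis
    proof (cases "t = 0")
      case True
      have "cinner (e n) v = 0" for n
        using sn[of n] True svd_zero_iff[OF X, of n] by (auto simp: cinner.zero_left)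
      thus ?thesis by (simp add: diag_op_orthogonal True)
    next
      case False
      have "(\<lambda>n. complex_of_real (t powr r / t) *\<^sub>C (complex_of_real (s n) * cinner (e n) v) *\<^sub>C e n)
          sums (complex_of_real (t powr r / t) *\<^sub>C diag_op s e v)"
        by (rule bounded_linear.sums[OF scaleC.bounded_linear_right diag_op_sums[where c = s, OF e svd_abs_bound[OF X]]])
      moreover have "complex_of_real (t powr r / t) *\<^sub>C (complex_of_real (s n) * cinner (e n) v) *\<^sub>C e n
          = (complex_of_real (s n powr r) * cinner (e n) v) *\<^sub>C e n" for n
        using sn[of n] False by (auto simp: scaleC_scaleC)
      moreover have "complex_of_real (t powr r / t) *\<^sub>C diag_op s e v = complex_of_real (t powr r) *\<^sub>C v"
        using False by (simp add: v scaleC_scaleC)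
      ultimately have "(\<lambda>n. (complex_of_real (s n powr r) * cinner (e n) v) *\<^sub>C e n) sums (complex_of_real (t powr r) *\<^sub>C v)"
        by (simp only:)
      thus ?thesis by (rule sums_unique2[OF diag_op_sums[where c = "\<lambda>n. s n powr r", OF e b]])
    qed
  qed
  thus "bounded_clinear (diag_op (\<lambda>n. s n powr r) e) \<and> (\<forall>t v. diag_op s e v = complex_of_real t *\<^sub>C v \<longrightarrow>
      diag_op (\<lambda>n. s n powr r) e v = complex_of_real (t powr r) *\<^sub>C v)"
    using bS by blast
  fix S assume S: "bounded_clinear S \<and> (\<forall>t v. diag_op s e v = complex_of_real t *\<^sub>C v \<longrightarrow>
      S v = complex_of_real (t powr r) *\<^sub>C v)"
  show "S = diag_op (\<lambda>n. s n powr r) e"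
  proof (rule bounded_clinear_eqI[OF e _ bS])
    fix v assume v: "\<And>n. cinner (e n) v = 0"
    have "diag_op s e v = complex_of_real 0 *\<^sub>C v" by (simp add: diag_op_orthogonal[OF v])
    hence "S v = complex_of_real (0 powr r) *\<^sub>C v" using S by blast
    thus "S v = diag_op (\<lambda>n. s n powr r) e v" by (simp add: diag_op_orthogonal[OF v])
  qed (use S in \<open>simp_all add: diag_op_vec[OF e]\<close>)
qed

text \<open>At the first index where the sequences differ, let t > 0 be the larger value. The other
  sequence attains t only before that index, where both agree, so the multiplicities differ.
  Convergence to 0 makes the index sets finite, without which \<open>card\<close> would return 0 and
  compare nothing.\<close>

lemma decseq_null_eqI:
  fixes s s' :: "nat \<Rightarrow> real"
  assumes s: "decseq s" "s \<longlonglongrightarrow> 0" and s': "decseq s'" "s' \<longlonglongrightarrow> 0"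
    and card: "\<And>t. 0 < t \<Longrightarrow> card {n. s n = t} = card {n. s' n = t}"
  shows "s = s'"
proof -
  have key: False
    if a: "decseq a" "a \<longlonglongrightarrow> 0" and b: "decseq b" "b \<longlonglongrightarrow> 0"
      and ab: "\<And>t. 0 < t \<Longrightarrow> card {n. a n = t} = card {n. b n = t}"
      and n: "b n < a n" and eq: "\<And>k. k < n \<Longrightarrow> a k = b k" for a b :: "nat \<Rightarrow> real" and n
  proof -
    have pos: "0 < a n" using decseq_ge[OF b] n by (rule le_less_trans)
    have "\<forall>\<^sub>F k in sequentially. a k < a n" using a(2) pos by (rule order_tendstoD)
    then obtain N where N: "\<And>k. N \<le> k \<Longrightarrow> a k < a n" unfolding eventually_sequentially by blast
    have "{k. a k = a n} \<subseteq> {..<N}"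
    proof
      fix k assume "k \<in> {k. a k = a n}"
      thus "k \<in> {..<N}" using N[of k] by (cases "N \<le> k") auto
    qed
    hence fin: "finite {k. a k = a n}" using finite_lessThan by (rule finite_subset)
    have "{k. b k = a n} \<subseteq> {k. a k = a n} - {n}"
    proof
      fix k assume "k \<in> {k. b k = a n}"
      hence k: "b k = a n" by simp
      have "k < n"
      proof (rule ccontr)
        assume "\<not> k < n"
        hence "b k \<le> b n" using b(1) by (simp add: decseqD)
        thus False using k n by simp
      qed
      thus "k \<in> {k. a k = a n} - {n}" using k eq by simp
    qed
    hence "card {k. b k = a n} \<le> card ({k. a k = a n} - {n})" using fin by (intro card_mono) auto
    also have "\<dots> < card {k. a k = a n}" using fin by (intro card_Diff1_less) auto
    finally show False using ab[OF pos] by simp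
  qed
  have "s n = s' n" for n
  proof (induction n rule: less_induct)
    case (less n)
    show ?case
    proof (rule ccontr)
      assume "s n \<noteq> s' n"
      hence "s' n < s n \<or> s n < s' n" by linarith
      thus False
        using key[OF s s' card] key[OF s' s card[symmetric]] less by metis
    qed
  qed
  thus ?thesis by blast
qed

text \<open>The \<open>e n\<close> with \<open>s n = t\<close> form an orthonormal basis of the
  eigenspace: an eigenvector v has no other components, so the series for t v is a finite sum, and t
  > 0 can be divided out.\<close>

lemma svd_eigenspace_dim:
  assumes X: "svd X s e" and t: "0 < t"
  shows "card {n. s n = t} = cdim {v. diag_op s e v = complex_of_real t *\<^sub>C v}"
proof -
  have e: "ortho_system e" by (rule svd_ortho[OF X])
  define I where "I = {n. s n = t}"
  have "\<forall>\<^sub>F k in sequentially. s k < t" using X t unfolding svd_def by (blast intro: order_tendstoD)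
  then obtain N where N: "\<And>k. N \<le> k \<Longrightarrow> s k < t" unfolding eventually_sequentially by blast
  have fin: "finite I"
  proof (rule finite_subset)
    show "I \<subseteq> {..<N}"
      unfolding I_def using N by (metis (mono_tags, lifting) lessThan_iff less_irrefl linorder_not_less mem_Collect_eq subsetI)
  qed simp
  have ip: "cinner (e m) (e n) = (if m = n then 1 else 0)" if "n \<in> I" for m n
    using e that t svd_norm_vec[OF X, of n] by (auto simp: ortho_system_def I_def cinner_self)
  have inj: "inj_on e I"
  proof (rule inj_onI)
    fix m n assume "m \<in> I" "n \<in> I" "e m = e n"
    thus "m = n" using ip[of n m] ip[of n n] by (auto split: if_splits)
  qed
  have "cdim {v. diag_op s e v = complex_of_real t *\<^sub>C v} = card (e ` I)"
  proof (rule complex_vector.dim_unique[OF _ _ _ refl])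
    show "e ` I \<subseteq> {v. diag_op s e v = complex_of_real t *\<^sub>C v}"
      by (auto simp: diag_op_vec[OF e] I_def)
    show "{v. diag_op s e v = complex_of_real t *\<^sub>C v} \<subseteq> cspan (e ` I)"
    proof
      fix v assume "v \<in> {v. diag_op s e v = complex_of_real t *\<^sub>C v}"
      hence v: "diag_op s e v = complex_of_real t *\<^sub>C v" by simp
      have "s n = t \<or> cinner (e n) v = 0" for n
        using cinner_diag_op[where c = s, OF e svd_abs_bound[OF X], of n v] by (auto simp: v cinner_simps)
      hence z: "cinner (e n) v = 0" if "n \<notin> I" for n using that by (metis I_def mem_Collect_eq)
      have "(\<lambda>n. (complex_of_real (s n) * cinner (e n) v) *\<^sub>C e n) sums (complex_of_real t *\<^sub>C v)"
        using diag_op_sums[where c = s, OF e svd_abs_bound[OF X], of v] by (simp add: v)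
      moreover have "(\<lambda>n. (complex_of_real (s n) * cinner (e n) v) *\<^sub>C e n) sums
          (\<Sum>n\<in>I. (complex_of_real (s n) * cinner (e n) v) *\<^sub>C e n)"
        by (intro sums_finite fin) (simp add: z)
      ultimately have "complex_of_real t *\<^sub>C v = (\<Sum>n\<in>I. (complex_of_real (s n) * cinner (e n) v) *\<^sub>C e n)"
        by (rule sums_unique2)
      also have "\<dots> \<in> cspan (e ` I)"
        by (intro complex_vector.span_sum complex_vector.span_scale complex_vector.span_base) simp
      finally have "complex_of_real (1 / t) *\<^sub>C complex_of_real t *\<^sub>C v \<in> cspan (e ` I)"
        by (rule complex_vector.span_scale)
      thus "v \<in> cspan (e ` I)" using t by (simp add: scaleC_scaleC scaleC_one)
    qed
    show "\<not> complex_vector.dependent (e ` I)"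
    proof
      assume "complex_vector.dependent (e ` I)"
      then obtain u k where u: "k \<in> I" "u (e k) \<noteq> 0" "(\<Sum>v\<in>e ` I. u v *\<^sub>C v) = 0"
        unfolding complex_vector.dependent_finite[OF finite_imageI[OF fin]] by blast
      have "0 = cinner (e k) (\<Sum>n\<in>I. u (e n) *\<^sub>C e n)"
        using u(3) by (simp add: sum.reindex[OF inj] cinner.zero_right)
      also have "\<dots> = (\<Sum>n\<in>I. if k = n then u (e k) else 0)"
        unfolding cinner.sum_right by (intro sum.cong) (auto simp: cinner_simps ip)
      also have "\<dots> = u (e k)" using u(1) fin by simp
      finally show False using u(2) by simp
    qed
  qed
  thus ?thesis unfolding card_image[OF inj] by (simp add: I_def)
qed

lemma singular_value_svd:
  assumes X: "svd X s e"
  shows "singular_value X = s"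
  unfolding singular_value_def abs_op_svd[OF X]
proof (rule the_equality)
  show *: "decseq s \<and> s \<longlonglongrightarrow> 0 \<and>
      (\<forall>t>0. card {n. s n = t} = cdim {v. diag_op s e v = complex_of_real t *\<^sub>C v})"
    using X svd_eigenspace_dim[OF X] by (simp add: svd_def)
  fix s' assume "decseq s' \<and> s' \<longlonglongrightarrow> 0 \<and>
      (\<forall>t>0. card {n. s' n = t} = cdim {v. diag_op s e v = complex_of_real t *\<^sub>C v})"
  thus "s' = s" using * by (intro decseq_null_eqI) simp_all
qed

text \<open>\<open>polar_part\<close> is chosen by \<open>SOME\<close>; the operator that sends each
  \<open>e n\<close> to its left singular vector and the complement of the system to 0 shows that a
  choice exists. The chosen operator may differ from it.\<close>

lemma polar_decomposition:
  assumes X: "svd X s e"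
  shows "partial_isometry (polar_part X) \<and> X = polar_part X \<circ> abs_op X"
proof -
  have bX: "bounded_clinear X" using X by (simp add: svd_def)
  have e: "ortho_system e" by (rule svd_ortho[OF X])
  define f where "f = left_vec X s e"
  have f: "ortho_system f" unfolding f_def by (rule ortho_left_vec[OF X])
  have nf: "norm (f n) = norm (e n)" for n by (simp add: f_def norm_left_vec[OF X] svd_norm_vec[OF X])
  define U where "U = series_op (\<lambda>_. 1) e f"
  have bU: "bounded_clinear U" and Us: "(\<lambda>n. cinner (e n) v *\<^sub>C f n) sums U v" for v
    using bounded_clinear_series_op[OF ortho_system_bessel[OF e] f, of "\<lambda>_. 1" 1]
      series_op_sums[OF ortho_system_bessel[OF e] f, of "\<lambda>_. 1" 1] by (simp_all add: U_def)
  have "norm (U v) = norm v" if v: "\<And>w. U w = 0 \<Longrightarrow> cinner w v = 0" for v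
  proof -
    \<comment> \<open>The component r outside the closed span of the system lies in the kernel of U;
      a vector orthogonal to the kernel therefore has r = 0.\<close>
    obtain x r where xr: "v = x + r" "(\<lambda>n. cinner (e n) v *\<^sub>C e n) sums x" "\<And>n. cinner (e n) r = 0"
      by (rule ortho_decomposition[OF e, of v]) blast
    have "U r = 0" unfolding U_def by (rule series_op_orthogonal[OF xr(3)])
    hence "cinner r v = 0" by (rule v)
    moreover have "cinner r x = 0"
    proof -
      have "(\<lambda>n. cinner r (cinner (e n) v *\<^sub>C e n)) sums cinner r x"
        by (rule bounded_linear.sums[OF cinner.bounded_linear_right xr(2)])
      moreover have "cinner r (cinner (e n) v *\<^sub>C e n) = 0" for n
        using xr(3)[of n] cinner_zero_commute[of r] by (simp add: cinner_simps)
      ultimately have "(\<lambda>n. 0) sums cinner r x" by simp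
      thus ?thesis by (rule sums_unique2[OF _ sums_zero])
    qed
    ultimately have "cinner r r = 0" by (simp add: xr(1) cinner_simps)
    hence "v = x" using xr(1) by (simp add: cinner_self)
    have "(norm (U v))\<^sup>2 = (norm x)\<^sup>2"
      by (rule sums_unique2[OF norm_ortho_sums[OF f Us]])
        (use norm_ortho_sums[OF e xr(2)] in \<open>simp add: nf\<close>)
    thus ?thesis using \<open>v = x\<close> by (simp add: power2_eq_iff_nonneg)
  qed
  hence "partial_isometry U" using bU by (simp add: partial_isometry_def)
  moreover have "X = U \<circ> abs_op X"
    unfolding abs_op_svd[OF X]
  proof (rule bounded_clinear_eqI[OF e bX bounded_clinear_compose[OF bU bounded_clinear_diag_op[where c = s, OF e svd_abs_bound[OF X]]]])
    fix n
    show "X (e n) = (U \<circ> diag_op s e) (e n)"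
    proof (cases "s n = 0")
      case True
      thus ?thesis using svd_apply[OF X, of n] by (simp add: diag_op_vec[OF e] bounded_clinear_zero[OF bU])
    next
      case False
      hence "norm (e n) = 1" by (simp add: svd_norm_vec[OF X])
      hence "U (e n) = f n" by (simp add: U_def series_op_vec[OF e] scaleC_one)
      thus ?thesis by (simp add: svd_apply[OF X] diag_op_vec[OF e] bounded_clinear_scaleC[OF bU] f_def)
    qed
  next
    fix v assume "\<And>n. cinner (e n) v = 0"
    thus "X v = (U \<circ> diag_op s e) v"
      using X by (simp add: svd_def diag_op_orthogonal bounded_clinear_zero[OF bU])
  qed
  ultimately have "\<exists>U. partial_isometry U \<and> X = U \<circ> abs_op X" by blast
  thus ?thesis unfolding polar_part_def by (rule someI_ex)
qed

text \<open>The ambiguity of the polar part does not reach the vectors \<open>e n\<close>, which lie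
  in the range of |X|: the factorization of X determines its values there.\<close>

lemma polar_part_vec:
  assumes X: "svd X s e"
  shows "polar_part X (e n) = left_vec X s e n"
proof -
  have bU: "bounded_clinear (polar_part X)"
    using polar_decomposition[OF X] by (simp add: partial_isometry_def)
  have "X (e n) = polar_part X (abs_op X (e n))" using polar_decomposition[OF X] by (metis comp_apply)
  also have "\<dots> = complex_of_real (s n) *\<^sub>C polar_part X (e n)"
    by (simp add: abs_op_svd[OF X] diag_op_vec[OF svd_ortho[OF X]] bounded_clinear_scaleC[OF bU])
  finally have "X (e n) = complex_of_real (s n) *\<^sub>C polar_part X (e n)" .
  moreover have "polar_part X (e n) = 0" if "s n = 0"
  proof -
    have "e n = 0" using that svd_zero_iff[OF X] by blast
    thus ?thesis by (simp add: bounded_clinear_zero[OF bU])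
  qed
  ultimately show ?thesis
    by (cases "s n = 0") (simp_all add: left_vec_def scaleC_scaleC scaleC_one)
qed

text \<open>Passing to the adjoint, <e_n, U* Y v> = <U e_n, Y v>, so the polar part U enters only
  through its values at the \<open>e n\<close>.\<close>

lemma dual_op_sums:
  assumes X: "svd X s e" and p: "1 < p"
  shows "(\<lambda>n. (complex_of_real (s n powr (p - 1)) * cinner (left_vec X s e n) (Y v)) *\<^sub>C e n)
    sums (op_powr (abs_op X) (p - 1) \<circ> cadjoint (polar_part X) \<circ> Y) v"
proof -
  have bU: "bounded_clinear (polar_part X)"
    using polar_decomposition[OF X] by (simp add: partial_isometry_def)
  have "\<bar>s n powr (p - 1)\<bar> \<le> s 0 powr (p - 1)" for n
    using p svd_le[OF X] svd_nonneg[OF X] by (simp add: powr_mono2)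
  from diag_op_sums[where c = "\<lambda>n. s n powr (p - 1)", OF svd_ortho[OF X] this, of "cadjoint (polar_part X) (Y v)"] p
  show ?thesis by (simp add: op_powr_svd[OF X] cadjoint_right[OF bU] polar_part_vec[OF X])
qed

section \<open>The trace pairing\<close>

lemma onb_cinner:
  assumes "orthonormal_basis B" "a \<in> B" "b \<in> B"
  shows "cinner a b = (if a = b then 1 else 0)"
  using assms by (auto simp: orthonormal_basis_def cinner_self)

lemma onb_cinner_sum:
  assumes B: "orthonormal_basis B" and F: "finite F" "F \<subseteq> B" "b \<in> F"
  shows "cinner b (\<Sum>a\<in>F. c a *\<^sub>C a) = c b"
proof -
  have "cinner b (\<Sum>a\<in>F. c a *\<^sub>C a) = (\<Sum>a\<in>F. if b = a then c b else 0)"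
    unfolding cinner.sum_right
  proof (rule sum.cong)
    fix a assume "a \<in> F"
    hence "cinner b a = (if b = a then 1 else 0)" using F by (intro onb_cinner[OF B]) auto
    thus "cinner b (c a *\<^sub>C a) = (if b = a then c b else 0)" by (simp add: cinner_simps)
  qed simp
  thus ?thesis using F by simp
qed

lemma onb_norm_sum:
  assumes B: "orthonormal_basis B" and F: "finite F" "F \<subseteq> B"
  shows "(norm (\<Sum>b\<in>F. c b *\<^sub>C b))\<^sup>2 = (\<Sum>b\<in>F. (cmod (c b))\<^sup>2)"
proof -
  have "complex_of_real ((norm (\<Sum>b\<in>F. c b *\<^sub>C b))\<^sup>2) = (\<Sum>b\<in>F. cnj (c b) * cinner b (\<Sum>a\<in>F. c a *\<^sub>C a))"
    unfolding cinner_self[symmetric] cinner.sum_left[of _ F] cinner_scaleC_left ..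
  also have "\<dots> = complex_of_real (\<Sum>b\<in>F. (cmod (c b))\<^sup>2)"
    unfolding of_real_sum complex_norm_square
    by (intro sum.cong) (simp_all add: onb_cinner_sum[OF B F])
  finally show ?thesis using of_real_eq_iff by blast
qed

text \<open>Pythagoras for the projection onto the span of F. With c = 0 it gives Bessel's
  inequality, with general c the best approximation property of the Fourier coefficients.\<close>

lemma onb_split:
  assumes B: "orthonormal_basis B" and F: "finite F" "F \<subseteq> B"
  shows "(norm (v - (\<Sum>b\<in>F. c b *\<^sub>C b)))\<^sup>2
    = (norm (v - (\<Sum>b\<in>F. cinner b v *\<^sub>C b)))\<^sup>2 + (\<Sum>b\<in>F. (cmod (cinner b v - c b))\<^sup>2)"
proof -
  define q where "q = (\<Sum>b\<in>F. cinner b v *\<^sub>C b)"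
  have d: "(\<Sum>b\<in>F. (cinner b v - c b) *\<^sub>C b) = q - (\<Sum>b\<in>F. c b *\<^sub>C b)"
    by (simp add: q_def complex_vector.scale_left_diff_distrib sum_subtractf)
  have "cinner (v - q) (\<Sum>b\<in>F. (cinner b v - c b) *\<^sub>C b) = 0"
    unfolding cinner.sum_right
  proof (intro sum.neutral ballI)
    fix b assume b: "b \<in> F"
    have "cinner b (v - q) = 0" unfolding q_def by (simp add: cinner_simps onb_cinner_sum[OF B F b])
    thus "cinner (v - q) ((cinner b v - c b) *\<^sub>C b) = 0"
      using cinner_zero_commute[of b "v - q"] by (simp only: cinner_scaleC_right mult_zero_right)
  qed
  hence "(norm ((v - q) + (\<Sum>b\<in>F. (cinner b v - c b) *\<^sub>C b)))\<^sup>2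
      = (norm (v - q))\<^sup>2 + (\<Sum>b\<in>F. (cmod (cinner b v - c b))\<^sup>2)"
    unfolding norm_add_square onb_norm_sum[OF B F] by simp
  thus ?thesis unfolding d by (simp add: q_def)
qed

lemma onb_bessel:
  assumes B: "orthonormal_basis B" and F: "finite F" "F \<subseteq> B"
  shows "(\<Sum>b\<in>F. (cmod (cinner b v))\<^sup>2) \<le> (norm v)\<^sup>2"
  using onb_split[OF B F, of v "\<lambda>_. 0"] by simp

text \<open>Density supplies one finite combination near w; by best approximation the Fourier sum
  over any finite set containing its index set is at least as near.\<close>

lemma onb_has_sum:
  assumes B: "orthonormal_basis B"
  shows "((\<lambda>b. cinner b w *\<^sub>C b) has_sum w) B"
  unfolding has_sum_def tendsto_iff
proof (intro allI impI)
  fix r :: real assume "0 < r"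
  moreover have "w \<in> closure (cspan B)" using B by (simp add: orthonormal_basis_def)
  ultimately obtain y where y: "y \<in> cspan B" "dist y w < r" unfolding closure_approachable by blast
  then obtain G c where G: "finite G" "G \<subseteq> B" "y = (\<Sum>b\<in>G. c b *\<^sub>C b)"
    unfolding complex_vector.span_explicit by blast
  have "dist (\<Sum>b\<in>F. cinner b w *\<^sub>C b) w < r" if F: "finite F" "G \<subseteq> F" "F \<subseteq> B" for F
  proof -
    have yF: "y = (\<Sum>b\<in>F. (if b \<in> G then c b else 0) *\<^sub>C b)"
      unfolding G(3) by (rule sum.mono_neutral_cong_left) (use F in auto)
    have "(norm (w - (\<Sum>b\<in>F. cinner b w *\<^sub>C b)))\<^sup>2 \<le> (norm (w - y))\<^sup>2"
      unfolding yF onb_split[OF B F(1,3), of w "\<lambda>b. if b \<in> G then c b else 0"] by (simp add: sum_nonneg)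
    hence "norm (w - (\<Sum>b\<in>F. cinner b w *\<^sub>C b)) \<le> norm (w - y)" by (rule power2_le_imp_le) simp
    thus ?thesis using y(2) by (simp add: dist_norm norm_minus_commute)
  qed
  thus "\<forall>\<^sub>F F in finite_subsets_at_top B. dist (\<Sum>b\<in>F. cinner b w *\<^sub>C b) w < r"
    unfolding eventually_finite_subsets_at_top using G by blast
qed

text \<open>The new vectors are the images of the \<open>e n\<close> under the contraction C that
  multiplies each b in F by \<open>\<theta> b\<close> and kills the complement of F; <C e_n, v> =
  <e_n, C* v> and |C* v| \<le> |v| carry Bessel's inequality over.\<close>

lemma bessel_contraction:
  assumes B: "orthonormal_basis B" and F: "finite F" "F \<subseteq> B"
    and \<theta>: "\<And>b. cmod (\<theta> b) \<le> 1" and e: "bessel e"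
  shows "bessel (\<lambda>n. \<Sum>b\<in>F. (\<theta> b * cinner b (e n)) *\<^sub>C b)"
  unfolding bessel_def
proof (intro allI)
  fix N v
  define v' where "v' = (\<Sum>b\<in>F. (cnj (\<theta> b) * cinner b v) *\<^sub>C b)"
  have "cinner (\<Sum>b\<in>F. (\<theta> b * cinner b (e n)) *\<^sub>C b) v = cinner (e n) v'" for n
    unfolding v'_def cinner.sum_left cinner.sum_right
    by (intro sum.cong) (simp_all add: cinner_simps cinner_commute[of "e n"])
  hence "(\<Sum>n<N. (cmod (cinner (\<Sum>b\<in>F. (\<theta> b * cinner b (e n)) *\<^sub>C b) v))\<^sup>2) \<le> (norm v')\<^sup>2"
    using e by (simp add: bessel_def)
  also have "\<dots> = (\<Sum>b\<in>F. (cmod (\<theta> b))\<^sup>2 * (cmod (cinner b v))\<^sup>2)"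
    unfolding v'_def onb_norm_sum[OF B F] by (simp add: norm_mult power_mult_distrib)
  also have "\<dots> \<le> (\<Sum>b\<in>F. (cmod (cinner b v))\<^sup>2)"
    using \<theta> by (intro sum_mono mult_left_le_one_le) (auto simp: power_le_one)
  also have "\<dots> \<le> (norm v)\<^sup>2" by (rule onb_bessel[OF B F])
  finally show "(\<Sum>n<N. (cmod (cinner (\<Sum>b\<in>F. (\<theta> b * cinner b (e n)) *\<^sub>C b) v))\<^sup>2) \<le> (norm v)\<^sup>2" .
qed

section \<open>Diagonal sums and the trace\<close>

lemma cnj_sgn_mult: "cnj (sgn z) * z = complex_of_real (cmod z)"
proof (cases "z = 0")
  case False
  have "cnj (sgn z) * z = complex_of_real ((cmod z)\<^sup>2) / complex_of_real (cmod z)"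
    unfolding complex_norm_square by (simp add: sgn_eq mult.commute)
  thus ?thesis using False by (simp add: power2_eq_square)
qed simp

text \<open>Choosing the phases \<open>\<theta>\<^sub>b\<close> of the diagonal entries turns a finite sum of their moduli into the
  pairing of Hoelder's inequality, taken along the contraction \<open>\<Sum>\<^sub>b \<theta>\<^sub>b b \<langle>b, \<cdot>\<rangle>\<close>.\<close>

lemma
  fixes Y :: "'a::chilbert_space \<Rightarrow> 'a"
  assumes Y: "svd Y t g" and p: "1 < p" and sm: "summable (\<lambda>m. t m powr p)"
    and T: "(\<Sum>m. t m powr p) \<le> T powr p" "0 < T"
    and e: "bessel e" and f: "bessel f"
    and a: "\<And>n. 0 \<le> a n" and A: "\<And>N. (\<Sum>n<N. a n powr p) \<le> A powr p" "0 < A"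
    and D: "\<And>v. (\<lambda>n. (complex_of_real (a n powr (p - 1)) * cinner (f n) (Y v)) *\<^sub>C e n) sums D v"
    and B: "orthonormal_basis B"
  shows diagonal_summable: "(\<lambda>b. cinner b (D b)) summable_on B"
    and norm_diagonal_infsum_le: "cmod (\<Sum>\<^sub>\<infinity>b\<in>B. cinner b (D b)) \<le> A powr (p - 1) * T"
proof -
  have bY: "bounded_clinear Y" using Y by (simp add: svd_def)
  have fin: "(\<Sum>b\<in>F. cmod (cinner b (D b))) \<le> A powr (p - 1) * T" if F: "finite F" "F \<subseteq> B" for F
  proof -
    define \<theta> where "\<theta> = (\<lambda>b. cnj (sgn (cinner b (D b))))"
    have \<theta>1: "cmod (\<theta> b) \<le> 1" for b by (simp add: \<theta>_def norm_sgn)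
    have \<theta>: "\<theta> b * cinner b (D b) = complex_of_real (cmod (cinner b (D b)))" for b
      by (simp add: \<theta>_def cnj_sgn_mult)
    define x where "x = (\<lambda>n. \<Sum>b\<in>F. (\<theta> b * cinner b (e n)) *\<^sub>C b)"
    define z where "z = (\<lambda>n. complex_of_real (a n powr (p - 1)) * cinner (f n) (Y (x n)))"
    have "(\<lambda>n. \<Sum>b\<in>F. \<theta> b * cinner b ((complex_of_real (a n powr (p - 1)) * cinner (f n) (Y b)) *\<^sub>C e n))
        sums (\<Sum>b\<in>F. \<theta> b * cinner b (D b))"
      by (intro sums_sum sums_mult bounded_linear.sums[OF cinner.bounded_linear_right] D)
    \<comment> \<open>By linearity of Y the phases and the coefficients along b move into the vector
      to which Y is applied, which becomes \<open>x n\<close>.\<close>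
    moreover have "(\<Sum>b\<in>F. \<theta> b * cinner b ((complex_of_real (a n powr (p - 1)) * cinner (f n) (Y b)) *\<^sub>C e n)) = z n" for n
      unfolding z_def x_def bounded_clinear_sum[OF bY] bounded_clinear_scaleC[OF bY] cinner.sum_right sum_distrib_left
      by (intro sum.cong) (simp_all add: cinner_simps mult_ac)
    ultimately have zs: "z sums complex_of_real (\<Sum>b\<in>F. cmod (cinner b (D b)))" by (simp add: \<theta>)
    have "cmod (\<Sum>n<N. z n) \<le> A powr (p - 1) * T" for N
    proof -
      have "cmod (\<Sum>n<N. z n) \<le> (\<Sum>n<N. a n powr (p - 1) * cmod (cinner (f n) (Y (x n))))"
        by (rule order_trans[OF norm_sum]) (simp add: z_def norm_mult)
      also have "\<dots> \<le> A powr (p - 1) * T"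
        unfolding x_def by (intro schatten_hoelder[OF Y p sm T] bessel_contraction[OF B F \<theta>1 e] f a A)
      finally show ?thesis .
    qed
    moreover have "(\<lambda>N. cmod (\<Sum>n<N. z n)) \<longlonglongrightarrow> cmod (complex_of_real (\<Sum>b\<in>F. cmod (cinner b (D b))))"
      using zs unfolding sums_def by (rule tendsto_norm)
    ultimately have "cmod (complex_of_real (\<Sum>b\<in>F. cmod (cinner b (D b)))) \<le> A powr (p - 1) * T"
      by (intro LIMSEQ_le_const2) auto
    thus ?thesis unfolding norm_of_real by linarith
  qed
  have abs: "(\<lambda>b. cmod (cinner b (D b))) summable_on B"
    unfolding abs_summable_iff_bdd_above using fin by (auto intro!: bdd_aboveI[of _ "A powr (p - 1) * T"])
  thus "(\<lambda>b. cinner b (D b)) summable_on B" by (rule abs_summable_summable)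
  have "cmod (\<Sum>\<^sub>\<infinity>b\<in>B. cinner b (D b)) \<le> (\<Sum>\<^sub>\<infinity>b\<in>B. cmod (cinner b (D b)))"
    by (rule norm_infsum_bound[OF abs])
  also have "\<dots> \<le> A powr (p - 1) * T" by (rule infsum_le_finite_sums[OF abs fin])
  finally show "cmod (\<Sum>\<^sub>\<infinity>b\<in>B. cinner b (D b)) \<le> A powr (p - 1) * T" .
qed

text \<open>For a single term, expand \<open>e n\<close> in the basis and apply the bounded
  functional that takes v to <f_n, Y v>; this is the trace of a rank-one operator in any
  basis.\<close>

lemma rank_one_trace:
  assumes B: "orthonormal_basis B" and Y: "bounded_clinear Y"
  shows "((\<lambda>b. cinner b (\<Sum>n<N. (c n * cinner (f n) (Y b)) *\<^sub>C e n)) has_sum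
    (\<Sum>n<(N::nat). c n * cinner (f n) (Y (e n)))) B"
proof (induction N)
  case 0
  show ?case by (simp add: cinner.zero_right)
next
  case (Suc N)
  have "bounded_linear (\<lambda>v. c N * cinner (f N) (Y v))"
    using Y unfolding bounded_clinear_def
    by (intro bounded_linear_const_mult bounded_linear_compose[OF cinner.bounded_linear_right]) blast
  from has_sum_bounded_linear[OF this onb_has_sum[OF B, of "e N"]]
  have "((\<lambda>b. cinner b ((c N * cinner (f N) (Y b)) *\<^sub>C e N)) has_sum c N * cinner (f N) (Y (e N))) B"
    by (simp add: bounded_clinear_scaleC[OF Y] cinner_simps mult_ac)
  from has_sum_add[OF Suc this] show ?case by (simp add: cinner_simps)
qed

text \<open>The finite part of the series has the expected trace. The remainder is a series of the
  same kind over shifted systems, and its diagonal sum is bounded through the tail of the series of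
  s^p, hence small.\<close>

lemma op_trace_sums:
  fixes X Y :: "'a::chilbert_space \<Rightarrow> 'a"
  assumes X: "svd X s e" and sX: "summable (\<lambda>n. s n powr p)"
    and Y: "svd Y t g" and sY: "summable (\<lambda>n. t n powr p)" and p: "1 < p"
  shows "(\<lambda>n. complex_of_real (s n powr (p - 1)) * cinner (left_vec X s e n) (Y (e n)))
    sums op_trace (op_powr (abs_op X) (p - 1) \<circ> cadjoint (polar_part X) \<circ> Y)"
proof -
  define D where "D = op_powr (abs_op X) (p - 1) \<circ> cadjoint (polar_part X) \<circ> Y"
  define f where "f = left_vec X s e"
  define B :: "'a set" where "B = (SOME B. orthonormal_basis B)"
  have B: "orthonormal_basis B" unfolding B_def by (rule someI_ex[OF orthonormal_basis_exists])
  have bY: "bounded_clinear Y" using Y by (simp add: svd_def)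
  have e: "bessel e" and f: "bessel f"
    by (auto simp: f_def intro!: ortho_system_bessel svd_ortho[OF X] ortho_left_vec[OF X])
  define c where "c = (\<lambda>n. complex_of_real (s n powr (p - 1)))"
  have D: "(\<lambda>n. (c n * cinner (f n) (Y v)) *\<^sub>C e n) sums D v" for v
    unfolding D_def f_def c_def by (rule dual_op_sums[OF X p])
  \<comment> \<open>The summand 1 keeps T positive, as the estimates demand, also for Y = 0.\<close>
  define T where "T = ((\<Sum>n. t n powr p) + 1) powr (1 / p)"
  have tp: "0 \<le> (\<Sum>n. t n powr p)" by (intro suminf_nonneg sY) simp
  have T: "(\<Sum>n. t n powr p) \<le> T powr p" "0 < T" using tp p by (simp_all add: T_def powr_powr)
  have "(\<lambda>N. \<Sum>n<N. c n * cinner (f n) (Y (e n))) \<longlonglongrightarrow> op_trace D"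
  proof (rule LIMSEQ_I)
    fix r :: real assume r: "0 < r"
    \<comment> \<open>Makes \<delta>^(p-1) T equal to r / 2, strictly below r.\<close>
    define \<delta> where "\<delta> = (r / (2 * T)) powr (1 / (p - 1))"
    have \<delta>: "0 < \<delta>" "\<delta> powr (p - 1) * T < r" using r T p by (simp_all add: \<delta>_def powr_powr)
    obtain N0 where N0: "\<And>N. N \<ge> N0 \<Longrightarrow> norm (\<Sum>i. s (i + N) powr p) < \<delta> powr p"
      using suminf_exist_split[OF _ sX, of "\<delta> powr p"] \<delta>(1) by auto
    have "cmod ((\<Sum>n<N. c n * cinner (f n) (Y (e n))) - op_trace D) < r" if N: "N \<ge> N0" for N
    proof -
      define H where "H = (\<lambda>v. \<Sum>n<N. (c n * cinner (f n) (Y v)) *\<^sub>C e n)"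
      have tail: "(\<Sum>n<M. s (n + N) powr p) \<le> \<delta> powr p" for M
      proof -
        have "(\<Sum>n<M. s (n + N) powr p) \<le> (\<Sum>n. s (n + N) powr p)"
          using sX by (intro sum_le_suminf) (simp_all add: summable_iff_shift[of "\<lambda>n. s n powr p"])
        also have "\<dots> \<le> \<delta> powr p" using N0[OF N] by simp
        finally show ?thesis .
      qed
      have R: "(\<lambda>n. (complex_of_real (s (n + N) powr (p - 1)) * cinner (f (n + N)) (Y v)) *\<^sub>C e (n + N))
          sums (D v - H v)" for v
        using sums_split_initial_segment[OF D[of v], of N] by (simp add: c_def H_def)
      note diag = Y p sY T bessel_shift[OF e, of N] bessel_shift[OF f, of N] svd_nonneg[OF X] tail \<delta>(1) R B
      have sR: "((\<lambda>b. cinner b (D b - H b)) has_sum (\<Sum>\<^sub>\<infinity>b\<in>B. cinner b (D b - H b))) B"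
        using diagonal_summable[OF diag] by (rule has_sum_infsum)
      have "((\<lambda>b. cinner b (H b)) has_sum (\<Sum>n<N. c n * cinner (f n) (Y (e n)))) B"
        unfolding H_def by (rule rank_one_trace[OF B bY])
      from has_sum_add[OF sR this]
      have "((\<lambda>b. cinner b (D b)) has_sum
          ((\<Sum>\<^sub>\<infinity>b\<in>B. cinner b (D b - H b)) + (\<Sum>n<N. c n * cinner (f n) (Y (e n))))) B"
        by (simp add: cinner_simps)
      hence "op_trace D = (\<Sum>\<^sub>\<infinity>b\<in>B. cinner b (D b - H b)) + (\<Sum>n<N. c n * cinner (f n) (Y (e n)))"
        unfolding op_trace_def B_def[symmetric] by (rule infsumI)
      hence "cmod ((\<Sum>n<N. c n * cinner (f n) (Y (e n))) - op_trace D) = cmod (\<Sum>\<^sub>\<infinity>b\<in>B. cinner b (D b - H b))"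
        by (simp add: norm_minus_commute)
      also have "\<dots> \<le> \<delta> powr (p - 1) * T" by (rule norm_diagonal_infsum_le[OF diag])
      finally show ?thesis using \<delta>(2) by linarith
    qed
    thus "\<exists>N0. \<forall>N\<ge>N0. cmod ((\<Sum>n<N. c n * cinner (f n) (Y (e n))) - op_trace D) < r" by blast
  qed
  thus ?thesis unfolding sums_def c_def f_def D_def .
qed

section \<open>Equality in the triangle and Hoelder inequalities\<close>

lemma schatten_class_svd:
  assumes X: "X \<in> schatten_class p" and p: "1 < p"
  obtains s e where "svd X s e" "(\<lambda>n. s n powr p) sums (schatten_norm p X powr p)"
proof -
  have "compact_op X" using X by (simp add: schatten_class_def)
  then obtain s e where svd: "svd X s e" by (rule compact_op_svd)
  have sm: "summable (\<lambda>n. s n powr p)" using X by (simp add: schatten_class_def singular_value_svd[OF svd])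
  hence "0 \<le> (\<Sum>n. s n powr p)" by (intro suminf_nonneg) auto
  hence "schatten_norm p X powr p = (\<Sum>n. s n powr p)"
    using p by (simp add: schatten_norm_def singular_value_svd[OF svd] powr_powr)
  thus ?thesis using that svd sm by (simp add: sums_iff)
qed

lemma schatten_norm_pos:
  assumes X: "X \<in> schatten_class p" and p: "1 < p" and nz: "X \<noteq> (\<lambda>_. 0)"
  shows "0 < schatten_norm p X"
proof (rule ccontr)
  assume "\<not> 0 < schatten_norm p X"
  hence z: "schatten_norm p X = 0" using powr_ge_zero[of _ "1 / p"] unfolding schatten_norm_def by (simp add: not_less order_antisym)
  obtain s e where svd: "svd X s e" and s: "(\<lambda>n. s n powr p) sums (schatten_norm p X powr p)"
    by (rule schatten_class_svd[OF X p]) blast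
  have "s n powr p = 0" for n
    using s suminf_eq_zero_iff[of "\<lambda>n. s n powr p"] z by (simp add: sums_iff)
  hence "s n = 0" for n by simp
  hence "cinner (e n) v = 0" for n v using svd_zero_iff[OF svd, of n] by (simp add: cinner.zero_left)
  hence "X = (\<lambda>_. 0)" using svd by (auto simp: svd_def)
  thus False using nz by blast
qed

text \<open>The right singular vectors stay, and the phase of k goes to the left ones. For k = 0 the
  link between zero vectors and zero values would break.\<close>

lemma svd_scale:
  assumes X: "svd X s e" and k: "k \<noteq> 0"
  shows "svd (\<lambda>v. k *\<^sub>C X v) (\<lambda>n. cmod k * s n) e"
proof -
  have bX: "bounded_clinear X" using X by (simp add: svd_def)
  have b: "bounded_clinear (\<lambda>v. k *\<^sub>C X v)"
    using bX unfolding bounded_clinear_def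
    by (auto intro: bounded_linear_compose[OF scaleC.bounded_linear_right] simp: scaleC_scaleC mult.commute)
  have "cadjoint (\<lambda>v. k *\<^sub>C X v) (k *\<^sub>C X (e n)) = complex_of_real ((cmod k * s n)\<^sup>2) *\<^sub>C e n" for n
  proof (rule cinner_extensionality)
    fix w
    have "cinner w (cadjoint (\<lambda>v. k *\<^sub>C X v) (k *\<^sub>C X (e n))) = cnj k * k * cinner w (cadjoint X (X (e n)))"
      by (simp add: cadjoint_right[OF b] cadjoint_right[OF bX] cinner_simps)
    also have "cnj k * k = complex_of_real ((cmod k)\<^sup>2)" by (simp add: complex_norm_square mult.commute del: of_real_power)
    also have "cadjoint X (X (e n)) = complex_of_real ((s n)\<^sup>2) *\<^sub>C e n" using X by (simp add: svd_def)
    finally show "cinner w (cadjoint (\<lambda>v. k *\<^sub>C X v) (k *\<^sub>C X (e n))) = cinner w (complex_of_real ((cmod k * s n)\<^sup>2) *\<^sub>C e n)"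
      by (simp add: cinner_simps power_mult_distrib mult_ac)
  qed
  moreover have "decseq (\<lambda>n. cmod k * s n)"
    using X unfolding svd_def decseq_def by (simp add: mult_left_mono)
  moreover have "(\<lambda>n. cmod k * s n) \<longlonglongrightarrow> 0" using X by (auto simp: svd_def intro: tendsto_mult_right_zero)
  ultimately show ?thesis using X b k by (auto simp: svd_def)
qed

section \<open>Stability of compact operators and Schatten classes\<close>

lemma compact_closure_subset:
  fixes K :: "'a::t2_space set"
  assumes K: "compact K" and S: "S \<subseteq> K"
  shows "compact (closure S)"
proof -
  have "K \<inter> closure S = closure S"
    by (intro Int_absorb1 closure_minimal S compact_imp_closed K)
  thus ?thesis using compact_Int_closed[OF K closed_closure, of S] by simp
qed

lemma compact_op_add:
  assumes X: "compact_op X" and Y: "compact_op Y"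
  shows "compact_op (\<lambda>v. X v + Y v)"
  unfolding compact_op_def
proof
  show "bounded_clinear (\<lambda>v. X v + Y v)"
    using X Y unfolding compact_op_def bounded_clinear_def
    by (auto intro: bounded_linear_add simp: scaleC_add_right)
  define K L where "K = closure (X ` cball 0 1)" and "L = closure (Y ` cball 0 1)"
  have c: "compact {x + y |x y. x \<in> K \<and> y \<in> L}"
    using X Y unfolding compact_op_def K_def L_def by (intro compact_sums) auto
  have "(\<lambda>v. X v + Y v) ` cball 0 1 \<subseteq> {x + y |x y. x \<in> K \<and> y \<in> L}"
    using closure_subset unfolding K_def L_def by blast
  thus "compact (closure ((\<lambda>v. X v + Y v) ` cball 0 1))" by (rule compact_closure_subset[OF c])
qed

lemma compact_op_scale:
  assumes X: "compact_op X"
  shows "compact_op (\<lambda>v. k *\<^sub>C X v)"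
  unfolding compact_op_def
proof
  show "bounded_clinear (\<lambda>v. k *\<^sub>C X v)"
    using X unfolding compact_op_def bounded_clinear_def
    by (auto intro: bounded_linear_compose[OF scaleC.bounded_linear_right] simp: scaleC_scaleC mult.commute)
  have c: "compact ((\<lambda>x. k *\<^sub>C x) ` closure (X ` cball 0 1))"
    using X unfolding compact_op_def
    by (intro compact_continuous_image linear_continuous_on scaleC.bounded_linear_right) auto
  have "(\<lambda>v. k *\<^sub>C X v) ` cball 0 1 \<subseteq> (\<lambda>x. k *\<^sub>C x) ` closure (X ` cball 0 1)"
    using closure_subset by blast
  thus "compact (closure ((\<lambda>v. k *\<^sub>C X v) ` cball 0 1))" by (rule compact_closure_subset[OF c])
qed

lemma
  assumes X: "X \<in> schatten_class p" and p: "1 < p" and k: "k \<noteq> 0"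
  shows schatten_class_scale: "(\<lambda>v. k *\<^sub>C X v) \<in> schatten_class p"
    and schatten_norm_scale: "schatten_norm p (\<lambda>v. k *\<^sub>C X v) = cmod k * schatten_norm p X"
proof -
  obtain s e where svd: "svd X s e" and s: "(\<lambda>n. s n powr p) sums (schatten_norm p X powr p)"
    by (rule schatten_class_svd[OF X p]) blast
  have sv: "singular_value (\<lambda>v. k *\<^sub>C X v) = (\<lambda>n. cmod k * s n)"
    by (rule singular_value_svd[OF svd_scale[OF svd k]])
  have N: "0 \<le> schatten_norm p X" by (simp add: schatten_norm_def)
  have "(\<lambda>n. (cmod k * s n) powr p) sums ((cmod k * schatten_norm p X) powr p)"
    using sums_mult[OF s, of "cmod k powr p"] svd_nonneg[OF svd] N by (simp add: powr_mult)
  thus "(\<lambda>v. k *\<^sub>C X v) \<in> schatten_class p"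
    and "schatten_norm p (\<lambda>v. k *\<^sub>C X v) = cmod k * schatten_norm p X"
    using X p N compact_op_scale[of X k] 
    by (simp_all add: schatten_class_def schatten_norm_def[of p "\<lambda>v. k *\<^sub>C X v"] sv sums_iff powr_powr)
qed

text \<open>Reduction to the normalized equality case: the phase goes into the left vectors and the
  factor y / x into the singular values. Then Y acts on the singular vectors of X like the stated
  multiple, and both operators vanish on the complement.\<close>

lemma hoelder_equality_imp_multiple:
  fixes X Y :: "'a::chilbert_space \<Rightarrow> 'a"
  assumes X: "svd X s e" and s: "(\<lambda>n. s n powr p) sums (x powr p)"
    and Y: "svd Y t g" and t: "(\<lambda>n. t n powr p) sums (y powr p)"
    and p: "1 < p" and x: "0 < x" and y: "0 < y" and \<theta>: "cmod \<theta> = 1"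
    and eq: "(\<lambda>n. s n powr (p - 1) * Re (\<theta> * cinner (left_vec X s e n) (Y (e n)))) sums (x powr (p - 1) * y)"
  shows "Y = (\<lambda>v. (complex_of_real (y / x) * cnj \<theta>) *\<^sub>C X v)"
proof -
  define f where "f = (\<lambda>n. cnj \<theta> *\<^sub>C left_vec X s e n)"
  define a where "a = (\<lambda>n. y / x * s n)"
  have e: "ortho_system e" by (rule svd_ortho[OF X])
  have bX: "bounded_clinear X" and bY: "bounded_clinear Y" using X Y by (simp_all add: svd_def)
  have f: "bessel f"
    using ortho_system_bessel[OF ortho_left_vec[OF X]] \<theta>
    by (simp add: bessel_def f_def cinner_simps norm_mult)
  have a0: "0 \<le> a n" for n using x y svd_nonneg[OF X] by (simp add: a_def)
  have az: "e n = 0" if "a n = 0" for n using that x y svd_zero_iff[OF X] by (simp add: a_def)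
  have "(\<lambda>n. (y / x) powr p * s n powr p) sums ((y / x) powr p * x powr p)" by (rule sums_mult[OF s])
  hence as: "(\<lambda>n. a n powr p) sums (y powr p)"
    using x y svd_nonneg[OF X] by (simp add: a_def powr_mult[symmetric])
  have "(\<lambda>n. (y / x) powr (p - 1) * (s n powr (p - 1) * Re (\<theta> * cinner (left_vec X s e n) (Y (e n)))))
      sums ((y / x) powr (p - 1) * (x powr (p - 1) * y))" by (rule sums_mult[OF eq])
  moreover have "(y / x) powr (p - 1) * (x powr (p - 1) * y) = y powr p"
    using x y by (simp add: powr_divide powr_diff)
  moreover have "(y / x) powr (p - 1) * (s n powr (p - 1) * Re (\<theta> * cinner (left_vec X s e n) (Y (e n))))
      = a n powr (p - 1) * Re (cinner (f n) (Y (e n)))" for n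
  proof -
    have "a n powr (p - 1) = (y / x) powr (p - 1) * s n powr (p - 1)"
      unfolding a_def by (rule powr_mult)
    thus ?thesis by (simp add: f_def cinner_simps)
  qed
  ultimately have eq': "(\<lambda>n. a n powr (p - 1) * Re (cinner (f n) (Y (e n)))) sums (y powr p)" by simp
  have Ye: "Y (e n) = complex_of_real (a n) *\<^sub>C f n" for n
    by (rule schatten_hoelder_eqD(1)[OF Y p t e f _ _ as eq']) (rule a0 az, assumption?)+
  have Yz: "Y v = 0" if "\<And>n. cinner (e n) v = 0" for v
    by (rule schatten_hoelder_eqD(2)[OF Y p t e f _ _ as eq' that]) (rule a0 az, assumption?)+
  show ?thesis
  proof (rule bounded_clinear_eqI[OF e bY])
    show "bounded_clinear (\<lambda>v. (complex_of_real (y / x) * cnj \<theta>) *\<^sub>C X v)"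
      using bX unfolding bounded_clinear_def
      by (auto intro: bounded_linear_compose[OF scaleC.bounded_linear_right] simp: scaleC_scaleC mult.commute)
    show "Y (e n) = (complex_of_real (y / x) * cnj \<theta>) *\<^sub>C X (e n)" for n
      using Ye[of n] by (simp add: svd_apply[OF X, of n] a_def f_def scaleC_scaleC mult_ac)
    show "Y v = (complex_of_real (y / x) * cnj \<theta>) *\<^sub>C X v" if "\<And>n. cinner (e n) v = 0" for v
      using Yz[OF that] X that by (simp add: svd_def)
  qed
qed

lemma svd_pairing_self:
  assumes X: "svd X s e"
  shows "complex_of_real (s n powr (p - 1)) * cinner (left_vec X s e n) (X (e n)) = complex_of_real (s n powr p)"
  using svd_nonneg[OF X, of n]
  by (cases "s n = 0") (simp_all add: svd_apply[OF X] cinner_simps cinner_self norm_left_vec[OF X] powr_diff)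

lemma schatten_alpha_imp_multiple:
  fixes X Y :: "'a::chilbert_space \<Rightarrow> 'a"
  assumes X: "X \<in> schatten_class p" "X \<noteq> (\<lambda>_. 0)" and Y: "Y \<in> schatten_class p" "Y \<noteq> (\<lambda>_. 0)"
    and p: "1 < p" and \<alpha>: "cmod (schatten_alpha p Y X) = 1"
  shows "\<exists>k. k \<noteq> 0 \<and> Y = (\<lambda>v. k *\<^sub>C X v)"
proof -
  define x y where "x = schatten_norm p X" and "y = schatten_norm p Y"
  have x: "0 < x" and y: "0 < y" unfolding x_def y_def by (rule schatten_norm_pos[OF _ p]; fact)+
  obtain s e where sX: "svd X s e" and s: "(\<lambda>n. s n powr p) sums (x powr p)"
    unfolding x_def by (rule schatten_class_svd[OF X(1) p]) blast
  obtain t g where sY: "svd Y t g" and t: "(\<lambda>n. t n powr p) sums (y powr p)"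
    unfolding y_def by (rule schatten_class_svd[OF Y(1) p]) blast
  define \<tau> where "\<tau> = op_trace (op_powr (abs_op X) (p - 1) \<circ> cadjoint (polar_part X) \<circ> Y)"
  have \<tau>: "(\<lambda>n. complex_of_real (s n powr (p - 1)) * cinner (left_vec X s e n) (Y (e n))) sums \<tau>"
    unfolding \<tau>_def by (rule op_trace_sums[OF sX _ sY _ p]) (use s t in \<open>simp_all add: sums_iff\<close>)
  have "cmod (schatten_alpha p Y X) = x powr (2 - p) * cmod \<tau> / (x * y)"
    using x y by (simp add: schatten_alpha_def schatten_sip_def \<tau>_def[symmetric] x_def[symmetric] y_def[symmetric]
        norm_mult norm_divide)
  hence "x powr (2 - p) * cmod \<tau> = x * y" using \<alpha> by simp
  also have "x * y = (x powr (2 - p) * x powr (p - 1)) * y" using x by (simp add: powr_add[symmetric])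
  finally have "x powr (2 - p) * cmod \<tau> = x powr (2 - p) * (x powr (p - 1) * y)"
    by (simp only: mult.assoc)
  hence c\<tau>: "cmod \<tau> = x powr (p - 1) * y" using x by simp
  hence nz: "\<tau> \<noteq> 0" using x y by auto
  \<comment> \<open>The phase that rotates \<tau> to its modulus, so that the real parts of the
    terms sum to Hoelder's bound.\<close>
  define \<theta> where "\<theta> = cnj (sgn \<tau>)"
  have \<theta>: "cmod \<theta> = 1" using nz by (simp add: \<theta>_def norm_sgn)
  have "\<theta> * \<tau> = complex_of_real (cmod \<tau>)"
    by (simp add: \<theta>_def cnj_sgn_mult)
  hence "(\<lambda>n. Re (\<theta> * (complex_of_real (s n powr (p - 1)) * cinner (left_vec X s e n) (Y (e n))))) sums (x powr (p - 1) * y)"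
    using sums_Re[OF sums_mult[OF \<tau>, of \<theta>]] by (simp add: c\<tau>)
  moreover have "Re (\<theta> * (complex_of_real (s n powr (p - 1)) * cinner (left_vec X s e n) (Y (e n))))
      = s n powr (p - 1) * Re (\<theta> * cinner (left_vec X s e n) (Y (e n)))" for n
    by (simp add: algebra_simps)
  ultimately have "(\<lambda>n. s n powr (p - 1) * Re (\<theta> * cinner (left_vec X s e n) (Y (e n)))) sums (x powr (p - 1) * y)"
    by (simp only:)
  from hoelder_equality_imp_multiple[OF sX s sY t p x y \<theta> this]
  show ?thesis using x y \<theta> by (intro exI[of _ "complex_of_real (y / x) * cnj \<theta>"]) auto
qed

lemma multiple_imp_schatten_alpha:
  fixes X :: "'a::chilbert_space \<Rightarrow> 'a"
  assumes X: "X \<in> schatten_class p" "X \<noteq> (\<lambda>_. 0)" and p: "1 < p" and k: "k \<noteq> 0"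
  shows "cmod (schatten_alpha p (\<lambda>v. k *\<^sub>C X v) X) = 1"
proof -
  define x where "x = schatten_norm p X"
  have x: "0 < x" unfolding x_def by (rule schatten_norm_pos[OF X(1) p X(2)])
  obtain s e where sX: "svd X s e" and s: "(\<lambda>n. s n powr p) sums (x powr p)"
    unfolding x_def by (rule schatten_class_svd[OF X(1) p]) blast
  have sm: "summable (\<lambda>n. s n powr p)" using s by (rule sums_summable)
  have smk: "summable (\<lambda>n. (cmod k * s n) powr p)"
    using summable_mult[OF sm, of "cmod k powr p"] svd_nonneg[OF sX] by (simp add: powr_mult)
  define \<tau> where "\<tau> = op_trace (op_powr (abs_op X) (p - 1) \<circ> cadjoint (polar_part X) \<circ> (\<lambda>v. k *\<^sub>C X v))"
  have "(\<lambda>n. complex_of_real (s n powr (p - 1)) * cinner (left_vec X s e n) (k *\<^sub>C X (e n))) sums \<tau>"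
    unfolding \<tau>_def by (rule op_trace_sums[OF sX sm svd_scale[OF sX k] smk p])
  hence "(\<lambda>n. k * (complex_of_real (s n powr (p - 1)) * cinner (left_vec X s e n) (X (e n)))) sums \<tau>"
    by (simp add: cinner_simps mult_ac)
  hence "(\<lambda>n. k * complex_of_real (s n powr p)) sums \<tau>" unfolding svd_pairing_self[OF sX] .
  moreover have "(\<lambda>n. k * complex_of_real (s n powr p)) sums (k * complex_of_real (x powr p))"
    by (intro sums_mult sums_of_real s)
  ultimately have "\<tau> = k * complex_of_real (x powr p)" by (rule sums_unique2)
  hence "cmod (schatten_alpha p (\<lambda>v. k *\<^sub>C X v) X) = x powr (2 - p) * (cmod k * x powr p) / (x * (cmod k * x))"
    using x schatten_norm_scale[OF X(1) p k]
    by (simp add: schatten_alpha_def schatten_sip_def \<tau>_def[symmetric] x_def[symmetric] norm_mult norm_divide)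
  also have "x powr (2 - p) * (cmod k * x powr p) = cmod k * (x * x)"
    using x by (simp add: powr_add[symmetric] power2_eq_square[symmetric] mult.left_commute)
  finally show ?thesis using x k by simp
qed

lemma multiple_imp_schatten_parallel:
  assumes X: "X \<in> schatten_class p" and p: "1 < p" and k: "k \<noteq> 0"
  shows "schatten_parallel p X (\<lambda>v. k *\<^sub>C X v)"
proof -
  \<comment> \<open>The phase with c k = |k|, so that the sum is a positive multiple of X.\<close>
  define c where "c = complex_of_real (cmod k) / k"
  have "X v + c *\<^sub>C k *\<^sub>C X v = complex_of_real (1 + cmod k) *\<^sub>C X v" for v
    using k by (simp add: c_def scaleC_scaleC scaleC_add_left scaleC_one)
  hence "(\<lambda>v. X v + c *\<^sub>C k *\<^sub>C X v) = (\<lambda>v. complex_of_real (1 + cmod k) *\<^sub>C X v)" by blast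
  moreover have "schatten_norm p (\<lambda>v. complex_of_real (1 + cmod k) *\<^sub>C X v) = (1 + cmod k) * schatten_norm p X"
  proof -
    have "cmod (complex_of_real (1 + cmod k)) = 1 + cmod k" by (simp only: norm_of_real) simp
    moreover have "complex_of_real (1 + cmod k) \<noteq> 0" unfolding of_real_eq_0_iff using norm_ge_zero[of k] by linarith
    ultimately show ?thesis using schatten_norm_scale[OF X p, of "complex_of_real (1 + cmod k)"] by simp
  qed
  moreover have "cmod c = 1" using k by (simp add: c_def norm_divide)
  ultimately show ?thesis
    unfolding schatten_parallel_def schatten_norm_scale[OF X p k]
    by (intro exI[of _ c]) (simp add: algebra_simps)
qed

lemma schatten_parallel_imp_multiple:
  fixes X Y :: "'a::chilbert_space \<Rightarrow> 'a"
  assumes X: "X \<in> schatten_class p" "X \<noteq> (\<lambda>_. 0)" and Y: "Y \<in> schatten_class p" "Y \<noteq> (\<lambda>_. 0)"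
    and p: "1 < p" and par: "schatten_parallel p X Y"
  shows "\<exists>k. k \<noteq> 0 \<and> Y = (\<lambda>v. k *\<^sub>C X v)"
proof -
  obtain c where c: "cmod c = 1"
    and eq: "schatten_norm p (\<lambda>v. X v + c *\<^sub>C Y v) = schatten_norm p X + schatten_norm p Y"
    using par unfolding schatten_parallel_def by blast
  have c0: "c \<noteq> 0" using c by force
  \<comment> \<open>Absorbing the phase c leaves the norm of Y unchanged.\<close>
  define W where "W = (\<lambda>v. c *\<^sub>C Y v)"
  define Z where "Z = (\<lambda>v. X v + W v)"
  define x w where "x = schatten_norm p X" and "w = schatten_norm p W"
  have W: "W \<in> schatten_class p" unfolding W_def by (rule schatten_class_scale[OF Y(1) p c0])
  have wY: "w = schatten_norm p Y" using schatten_norm_scale[OF Y(1) p c0] c by (simp add: w_def W_def)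
  have x: "0 < x" and w: "0 < w" unfolding x_def wY by (rule schatten_norm_pos[OF _ p]; fact)+
  define z where "z = x + w"
  have z: "0 < z" using x w by (simp add: z_def)
  have Zz: "schatten_norm p Z = z" using eq by (simp add: Z_def W_def z_def x_def wY)
  obtain s e where sX: "svd X s e" and s: "(\<lambda>n. s n powr p) sums (x powr p)"
    unfolding x_def by (rule schatten_class_svd[OF X(1) p]) blast
  obtain t g where sW: "svd W t g" and t: "(\<lambda>n. t n powr p) sums (w powr p)"
    unfolding w_def by (rule schatten_class_svd[OF W p]) blast
  have "compact_op Z"
    unfolding Z_def using X(1) W by (intro compact_op_add) (simp_all add: schatten_class_def)
  then obtain \<sigma> u where sZ: "svd Z \<sigma> u" by (rule compact_op_svd)
  define f where "f = left_vec Z \<sigma> u"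
  define ip where "ip = (\<lambda>V n. \<sigma> n powr (p - 1) * cinner (f n) (V (u n)))"
  have u: "bessel u" and f: "bessel f"
    by (auto simp: f_def intro!: ortho_system_bessel svd_ortho[OF sZ] ortho_left_vec[OF sZ])
  have \<sigma>0: "0 \<le> \<sigma> n" for n by (rule svd_nonneg[OF sZ])
  have split: "\<sigma> n powr p = Re (ip X n) + Re (ip W n)" for n
  proof -
    have "complex_of_real (\<sigma> n powr p) = ip X n + ip W n"
      using svd_pairing_self[OF sZ, of n p] by (simp add: ip_def f_def Z_def cinner_simps distrib_left)
    thus ?thesis by (metis Re_complex_of_real plus_complex.sel(1))
  qed
  have hoelder: "(\<Sum>n<N. \<bar>Re (ip V n)\<bar>) \<le> A powr (p - 1) * v"
    if V: "svd V r h" "(\<lambda>n. r n powr p) sums (v powr p)" "0 < v"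
      and A: "(\<Sum>n<N. \<sigma> n powr p) \<le> A powr p" "0 < A" for V r h v A N
  proof -
    have "(\<Sum>n<N. \<bar>Re (ip V n)\<bar>) \<le> (\<Sum>n<N. \<sigma> n powr (p - 1) * cmod (cinner (f n) (V (u n))))"
      by (intro sum_mono order_trans[OF abs_Re_le_cmod]) (simp add: ip_def norm_mult)
    also have "\<dots> \<le> A powr (p - 1) * v"
      by (rule schatten_hoelder[OF V(1) p _ _ V(3) u f \<sigma>0 A]) (use V(2) in \<open>simp_all add: sums_iff\<close>)
    finally show ?thesis .
  qed
  \<comment> \<open>Duality proof of Minkowski's inequality on a finite section: if A^p is the
    partial sum, the split and Hoelder's inequality give A^p \<le> A^(p-1) z, and division leaves A
    \<le> z. A vanishing sum is treated apart because A must be positive.\<close>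
  have bound: "(\<Sum>n<N. \<sigma> n powr p) \<le> z powr p" for N
  proof (cases "(\<Sum>n<N. \<sigma> n powr p) = 0")
    case False
    define A where "A = (\<Sum>n<N. \<sigma> n powr p) powr (1 / p)"
    have S0: "0 \<le> (\<Sum>n<N. \<sigma> n powr p)" by (intro sum_nonneg) simp
    have A: "(\<Sum>n<N. \<sigma> n powr p) = A powr p" "0 < A" using p S0 False by (simp_all add: A_def powr_powr)
    have "A powr (p - 1) * A = A powr p" using A(2) by (simp add: powr_diff)
    also have "\<dots> = (\<Sum>n<N. Re (ip X n)) + (\<Sum>n<N. Re (ip W n))"
      unfolding A(1)[symmetric] split by (rule sum.distrib)
    also have "\<dots> \<le> (\<Sum>n<N. \<bar>Re (ip X n)\<bar>) + (\<Sum>n<N. \<bar>Re (ip W n)\<bar>)"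
      by (intro add_mono sum_mono) auto
    also have "\<dots> \<le> A powr (p - 1) * x + A powr (p - 1) * w"
      by (intro add_mono hoelder[OF sX s x] hoelder[OF sW t w]) (use A in auto)
    also have "\<dots> = A powr (p - 1) * z" by (simp add: z_def distrib_left)
    finally have "A \<le> z" using A(2) by simp
    thus ?thesis unfolding A(1) using A(2) p by (simp add: powr_mono2)
  qed simp
  have sm: "summable (\<lambda>n. \<sigma> n powr p)"
    by (rule summableI_nonneg_bounded[of _ "z powr p", OF _ bound]) simp
  \<comment> \<open>Only with summability at hand does \<open>schatten_norm p Z = z\<close> say
    something about the singular values, since the norm is defined through an infinite sum.\<close>
  have \<sigma>: "(\<lambda>n. \<sigma> n powr p) sums (z powr p)"
  proof -
    have "(\<Sum>n. \<sigma> n powr p) = z powr p"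
      using Zz p suminf_nonneg[OF sm] by (auto simp: schatten_norm_def singular_value_svd[OF sZ] powr_powr)
    thus ?thesis using sm by (simp add: sums_iff)
  qed
  have sums: "summable (\<lambda>n. Re (ip V n)) \<and> (\<Sum>n. Re (ip V n)) \<le> z powr (p - 1) * v"
    if V: "svd V r h" "(\<lambda>n. r n powr p) sums (v powr p)" "0 < v" for V r h v
  proof -
    have b: "(\<Sum>n<N. \<bar>Re (ip V n)\<bar>) \<le> z powr (p - 1) * v" for N by (rule hoelder[OF V bound z])
    have sa: "summable (\<lambda>n. \<bar>Re (ip V n)\<bar>)"
      by (rule summableI_nonneg_bounded[of _ "z powr (p - 1) * v", OF _ b]) simp
    have "(\<Sum>n. Re (ip V n)) \<le> (\<Sum>n. \<bar>Re (ip V n)\<bar>)"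
      by (intro suminf_le sa summable_rabs_cancel[OF sa]) simp
    also have "\<dots> \<le> z powr (p - 1) * v" by (intro suminf_le_const sa b)
    finally show ?thesis using summable_rabs_cancel[OF sa] by blast
  qed
  note eX = sums[OF sX s x] and eW = sums[OF sW t w]
  \<comment> \<open>The two sums add up to z^p = z^(p-1) (x + w), while each is bounded by its own
    share; so both bounds are attained.\<close>
  have "(\<Sum>n. Re (ip X n)) + (\<Sum>n. Re (ip W n)) = z powr p"
    using sums_unique[OF \<sigma>] suminf_add[of "\<lambda>n. Re (ip X n)" "\<lambda>n. Re (ip W n)"] eX eW by (simp add: split)
  also have "\<dots> = z powr (p - 1) * x + z powr (p - 1) * w"
    using z unfolding distrib_left[symmetric] z_def[symmetric] by (simp add: powr_diff)
  finally have "(\<Sum>n. Re (ip X n)) = z powr (p - 1) * x" "(\<Sum>n. Re (ip W n)) = z powr (p - 1) * w"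
    using eX eW by linarith+
  hence "(\<lambda>n. Re (ip X n)) sums (z powr (p - 1) * x)" "(\<lambda>n. Re (ip W n)) sums (z powr (p - 1) * w)"
    using eX eW by (simp_all add: sums_iff)
  hence "(\<lambda>n. \<sigma> n powr (p - 1) * Re (1 * cinner (left_vec Z \<sigma> u n) (X (u n)))) sums (z powr (p - 1) * x)"
    "(\<lambda>n. \<sigma> n powr (p - 1) * Re (1 * cinner (left_vec Z \<sigma> u n) (W (u n)))) sums (z powr (p - 1) * w)"
    by (simp_all add: ip_def f_def)
  from hoelder_equality_imp_multiple[OF sZ \<sigma> sX s p z x _ this(1)]
    hoelder_equality_imp_multiple[OF sZ \<sigma> sW t p z w _ this(2)]
  have XZ: "X = (\<lambda>v. complex_of_real (x / z) *\<^sub>C Z v)" and WZ: "W = (\<lambda>v. complex_of_real (w / z) *\<^sub>C Z v)" by simp_all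
  have "Y v = (complex_of_real (w / x) / c) *\<^sub>C X v" for v
  proof -
    have "Y v = (1 / c) *\<^sub>C W v" using c0 by (simp add: W_def scaleC_scaleC scaleC_one)
    also have "W v = complex_of_real (w / x) *\<^sub>C X v"
      using x z fun_cong[OF WZ, of v] fun_cong[OF XZ, of v] by (simp add: scaleC_scaleC)
    finally show ?thesis by (simp add: scaleC_scaleC)
  qed
  thus ?thesis using x w c0 by (intro exI[of _ "complex_of_real (w / x) / c"]) auto
qed

lemma multiple_commute:
  fixes X Y :: "'a::chilbert_space \<Rightarrow> 'a"
  assumes "\<exists>k. k \<noteq> 0 \<and> Y = (\<lambda>v. k *\<^sub>C X v)"
  shows "\<exists>k. k \<noteq> 0 \<and> X = (\<lambda>v. k *\<^sub>C Y v)"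
proof -
  obtain k where "k \<noteq> 0" "Y = (\<lambda>v. k *\<^sub>C X v)" using assms by blast
  thus ?thesis by (intro exI[of _ "1 / k"]) (simp add: scaleC_scaleC scaleC_one)
qed

theorem theorem4p1:
  fixes X Y :: "'a::chilbert_space \<Rightarrow> 'a" and p :: real
  assumes "separable_space (euclidean :: 'a topology)"
    and "p > 1"
    and "X \<in> schatten_class p" and "X \<noteq> (\<lambda>_. 0)"
    and "Y \<in> schatten_class p" and "Y \<noteq> (\<lambda>_. 0)"
  shows "(cmod (schatten_alpha p Y X) = 1 \<longleftrightarrow> schatten_parallel p X Y) \<and>
         (schatten_parallel p X Y \<longleftrightarrow> schatten_parallel p Y X) \<and>
         (schatten_parallel p Y X \<longleftrightarrow> cmod (schatten_alpha p X Y) = 1)"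
proof -
  have alpha: "cmod (schatten_alpha p V U) = 1 \<longleftrightarrow> (\<exists>k. k \<noteq> 0 \<and> V = (\<lambda>v. k *\<^sub>C U v))"
    and parallel: "schatten_parallel p U V \<longleftrightarrow> (\<exists>k. k \<noteq> 0 \<and> V = (\<lambda>v. k *\<^sub>C U v))"
    if "U \<in> schatten_class p" "U \<noteq> (\<lambda>_. 0)" "V \<in> schatten_class p" "V \<noteq> (\<lambda>_. 0)"
    for U V :: "'a \<Rightarrow> 'a"
    using that \<open>p > 1\<close> schatten_alpha_imp_multiple[of U p V] multiple_imp_schatten_alpha[of U p]
      schatten_parallel_imp_multiple[of U p V] multiple_imp_schatten_parallel[of U p] by blast+
  show ?thesis
    using alpha[OF assms(3-6)] parallel[OF assms(3-6)] alpha[OF assms(5,6,3,4)] parallel[OF assms(5,6,3,4)]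
      multiple_commute[of X Y] multiple_commute[of Y X] by argo
qed

end
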